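(* Let $X$ be a Banach space and let $Y \subseteq X$ be a closed linear subspace. Suppose that the quotient $X/Y$ satisfies one of the following conditions: (i) every non-empty $w^*$-closed subset of $B_{(X/Y)^*}$ has a $G_\delta$-point (in the relative $w^*$-topology); (ii) $\mathrm{dens}(X/Y)<\mathfrak{s}$. Then $Y$ is $w^*$-extensible in $X$.
   Context: For a Banach space $Z$, $Z^*$ is its topological dual, $B_{Z^*}$ is the closed unit ball of $Z^*$, and $w^*$ denotes the weak$^*$ topology on $Z^*$. A closed linear subspace $Y\subseteq X$ is $w^*$-extensible in $X$ if for every $w^*$-convergent sequence $(y_n^* )_{n\in\mathbb{N}}$ in $Y^*$ there exist a subsequence $(y_{n_k}^* )_{k\in\mathbb{N}}$ and a $w^*$-convergent sequence $(x_k^* )_{k\in\mathbb{N}}$ in $X^*$ such that $x_k^*|_Y=y_{n_k}^*$ for all $k\in\mathbb{N}$. A point $t$ of a compact Hausdorff space $K$ is a $G_\delta$-point (in $K$) if there is a sequence of open subsets of $K$ whose intersection is $\{t\}$. $\mathrm{dens}(Z)$ is the density character of $Z$, i.e. the smallest cardinality of a dense subset of $Z$. The splitting number $\mathfrak{s}$ is the minimum of all cardinals $\kappa$ for which there is a compact Hausdorff space of weight $\kappa$ that is not sequentially compact, where the weight of a space is the smallest cardinality of a base of its topology. *)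

theory Defs
  imports "HOL-Analysis.Analysis" "HOL-Library.Set_Algebras"
begin

unbundle cardinal_syntax

text \<open>
  The statement involves the duals of a Banach space, of a subspace of it and of a quotient of it.
  The last two depend on a term, so they are not types; all three are treated as (real) normed
  spaces with an explicit carrier.
\<close>

record 'a nspace =
  points :: "'a set"
  add :: "'a \<Rightarrow> 'a \<Rightarrow> 'a"
  scale :: "real \<Rightarrow> 'a \<Rightarrow> 'a"
  nrm :: "'a \<Rightarrow> real"

definition linear_subspace :: "'a::real_normed_vector set \<Rightarrow> 'a nspace" where
  "linear_subspace S = \<lparr>points = S, add = (+), scale = (*\<^sub>R), nrm = norm\<rparr>"

abbreviation whole_space :: "'a::real_normed_vector nspace" where
  "whole_space \<equiv> linear_subspace UNIV"

text \<open>
  The elements of the quotient are the cosets of \<open>Y\<close>. In \<open>scale\<close>, the summand \<open>Y\<close> matters only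
  for the scalar \<open>0\<close>, where the image of a coset is \<open>{0}\<close> and not the coset \<open>Y\<close>.
\<close>

definition quotient_space :: "'a::real_normed_vector set \<Rightarrow> 'a set nspace" where
  "quotient_space Y =
     \<lparr>points = range (\<lambda>x. x +o Y),
      add = (+),
      scale = (\<lambda>c A. (*\<^sub>R) c ` A + Y),
      nrm = (\<lambda>A. INF a\<in>A. norm a)\<rparr>"

lemma quotient_space_add_coset:
  assumes "subspace Y"
  shows "add (quotient_space Y) (x +o Y) (y +o Y) = (x + y) +o Y"
proof -
  have "Y + Y = Y"
  proof
    show "Y + Y \<subseteq> Y"
      using assms by (auto simp: set_plus_def subspace_add)
    show "Y \<subseteq> Y + Y"
    proof
      fix y assume "y \<in> Y"
      then show "y \<in> Y + Y"
        using set_plus_intro[of y Y 0 Y] subspace_0[OF assms] by simp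
    qed
  qed
  then show ?thesis
    by (simp add: quotient_space_def set_plus_rearrange)
qed

lemma quotient_space_scale_coset:
  assumes "subspace Y"
  shows "scale (quotient_space Y) c (x +o Y) = (c *\<^sub>R x) +o Y"
proof
  show "scale (quotient_space Y) c (x +o Y) \<subseteq> (c *\<^sub>R x) +o Y"
  proof
    fix z assume "z \<in> scale (quotient_space Y) c (x +o Y)"
    then obtain u v where "u \<in> Y" "v \<in> Y" "z = c *\<^sub>R (x + u) + v"
      by (auto simp: quotient_space_def set_plus_def elt_set_plus_def)
    then have "z = c *\<^sub>R x + (c *\<^sub>R u + v)" "c *\<^sub>R u + v \<in> Y"
      using assms by (auto simp: algebra_simps subspace_add subspace_scale)
    then show "z \<in> (c *\<^sub>R x) +o Y"
      by (auto simp: elt_set_plus_def)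
  qed
  show "(c *\<^sub>R x) +o Y \<subseteq> scale (quotient_space Y) c (x +o Y)"
  proof
    fix z assume "z \<in> (c *\<^sub>R x) +o Y"
    then obtain v where v: "v \<in> Y" "z = c *\<^sub>R x + v"
      by (auto simp: elt_set_plus_def)
    have "x \<in> x +o Y"
      using subspace_0[OF assms] by (force simp: elt_set_plus_def)
    with v show "z \<in> scale (quotient_space Y) c (x +o Y)"
      by (auto simp: quotient_space_def set_plus_def)
  qed
qed

text \<open>
  Functionals are kept \<open>undefined\<close> outside the carrier, so that equality of functionals is
  equality of functions.
\<close>

definition dual :: "'a nspace \<Rightarrow> ('a \<Rightarrow> real) set" where
  "dual Z = {f \<in> extensional (points Z).
     (\<forall>x\<in>points Z. \<forall>y\<in>points Z. f (add Z x y) = f x + f y) \<and>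
     (\<forall>c. \<forall>x\<in>points Z. f (scale Z c x) = c * f x) \<and>
     (\<exists>C. \<forall>x\<in>points Z. \<bar>f x\<bar> \<le> C * nrm Z x)}"

definition dual_norm :: "'a nspace \<Rightarrow> ('a \<Rightarrow> real) \<Rightarrow> real" where
  "dual_norm Z f = (SUP x\<in>{x \<in> points Z. nrm Z x \<le> 1}. \<bar>f x\<bar>)"

definition dual_ball :: "'a nspace \<Rightarrow> ('a \<Rightarrow> real) set" where
  "dual_ball Z = {f \<in> dual Z. dual_norm Z f \<le> 1}"

definition weak_star :: "'a nspace \<Rightarrow> ('a \<Rightarrow> real) topology" where
  "weak_star Z = subtopology (product_topology (\<lambda>_. euclideanreal) (points Z)) (dual Z)"

lemma topspace_weak_star: "topspace (weak_star Z) = dual Z"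
  by (auto simp: weak_star_def dual_def PiE_def)

definition weak_star_convergent :: "'a nspace \<Rightarrow> (nat \<Rightarrow> 'a \<Rightarrow> real) \<Rightarrow> bool" where
  "weak_star_convergent Z f \<longleftrightarrow>
     (\<forall>n. f n \<in> dual Z) \<and> (\<exists>l. limitin (weak_star Z) f l sequentially)"

definition weak_star_extensible :: "'a::real_normed_vector set \<Rightarrow> bool" where
  "weak_star_extensible Y \<longleftrightarrow>
     (\<forall>f. weak_star_convergent (linear_subspace Y) f \<longrightarrow>
        (\<exists>r g. strict_mono (r :: nat \<Rightarrow> nat) \<and> weak_star_convergent whole_space g \<and>
               (\<forall>k. restrict (g k) Y = f (r k))))"

definition Gdelta_point :: "'a topology \<Rightarrow> 'a \<Rightarrow> bool" where
  "Gdelta_point K t \<longleftrightarrow>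
     (\<exists>U :: nat \<Rightarrow> 'a set. (\<forall>n. openin K (U n)) \<and> (\<Inter>n. U n) = {t})"

text \<open>Cardinals are represented, as in the library, by cardinal orders up to \<open>=o\<close>.\<close>

definition min_card :: "'a rel set \<Rightarrow> 'a rel" where
  "min_card R = (SOME r. r \<in> R \<and> (\<forall>r'\<in>R. r \<le>o r'))"

lemma min_card:
  assumes "R \<noteq> {}" "\<And>r. r \<in> R \<Longrightarrow> Card_order r"
  shows "min_card R \<in> R" "\<And>r. r \<in> R \<Longrightarrow> min_card R \<le>o r"
proof -
  have "\<exists>r. r \<in> R \<and> (\<forall>r'\<in>R. r \<le>o r')"
    using exists_minim_Card_order[of R] assms by blast
  from someI_ex[OF this] show "min_card R \<in> R" "\<And>r. r \<in> R \<Longrightarrow> min_card R \<le>o r"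
    unfolding min_card_def by auto
qed

definition dense_in_nspace :: "'a nspace \<Rightarrow> 'a set \<Rightarrow> bool" where
  "dense_in_nspace Z D \<longleftrightarrow> D \<subseteq> points Z \<and>
     (\<forall>x\<in>points Z. \<forall>e>0. \<exists>d\<in>D. nrm Z (add Z x (scale Z (-1) d)) < e)"

definition dens :: "'a nspace \<Rightarrow> 'a rel" where
  "dens Z = min_card {|D| | D. dense_in_nspace Z D}"

definition base_of :: "'a topology \<Rightarrow> 'a set set \<Rightarrow> bool" where
  "base_of K \<B> \<longleftrightarrow> (\<forall>V\<in>\<B>. openin K V) \<and>
     (\<forall>U x. openin K U \<and> x \<in> U \<longrightarrow> (\<exists>V\<in>\<B>. x \<in> V \<and> V \<subseteq> U))"

definition weight :: "'a topology \<Rightarrow> 'a set rel" where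
  "weight K = min_card {|\<B>| | \<B>. base_of K \<B>}"

definition seq_compact_topology :: "'a topology \<Rightarrow> bool" where
  "seq_compact_topology K \<longleftrightarrow>
     (\<forall>f :: nat \<Rightarrow> 'a. (\<forall>n. f n \<in> topspace K) \<longrightarrow>
        (\<exists>l r. strict_mono (r :: nat \<Rightarrow> nat) \<and> limitin K (f \<circ> r) l sequentially))"

text \<open>
  One cannot quantify over the types of points of all compact Hausdorff spaces inside a definition,
  but topologies with points in \<open>real set\<close> (and arbitrary topspace) suffice. Write \<open>c\<close> for the
  cardinality of the continuum. The minimum is at most \<open>c\<close>, since the power of the
  two-point space with exponent \<open>c\<close> is not sequentially compact. A compact Hausdorff space of
  weight at most \<open>c\<close> embeds in the power of the unit interval with exponent \<open>c\<close>, so it has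
  at most \<open>2 ^ c\<close> points and is homeomorphic to a topology on a subset of \<open>real set\<close>.
\<close>

definition splitting_number :: "real set set rel" where
  "splitting_number =
     min_card {weight K | K :: real set topology.
       compact_space K \<and> Hausdorff_space K \<and> \<not> seq_compact_topology K}"

end

theory Submission
  imports Defs
begin

text \<open>
  After subtracting the limit, a weak* convergent sequence in the dual of \<open>Y\<close> is null and, by uniform
  boundedness, bounded. Let \<open>f\<^sub>n\<close> be uniformly bounded Hahn-Banach extensions to \<open>X\<close>. In both cases
  a subsequence of \<open>f\<^sub>n\<close> itself is weak* convergent.

  (i) The weak* cluster points of \<open>f\<^sub>n\<close> form a non-empty compact set \<open>C\<close> of functionals vanishing on \<open>Y\<close>,
  which is, up to scaling, a weak* closed subset of the dual ball of \<open>X/Y\<close>. If \<open>t\<close> is a \<open>G\<^sub>\<delta>\<close>-point of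
  \<open>C\<close>, then countably many points of \<open>X\<close> separate \<open>t\<close> from the rest of \<open>C\<close>. A subsequence converging to
  \<open>t\<close> at these points has \<open>t\<close> as its only cluster point, so it converges to \<open>t\<close>.

  (ii) For a set \<open>D\<close> of size below the splitting number, the cube \<open>2\<^sup>D\<close> is sequentially compact, hence
  so is every product of \<open>D\<close> bounded intervals. So some subsequence converges at representatives of a
  dense set of cosets; it also converges on \<open>Y\<close>, hence, being bounded, everywhere.
\<close>

section \<open>Hahn-Banach and uniform boundedness\<close>

text \<open>A maximal dominated graph is total, because a value at a missing point can always be
  chosen so that the bound survives. The one-sided bound at \<open>x\<close> and at
  \<open>- x\<close> gives the bound on the absolute value.\<close>

lemma Hahn_Banach_extension:
  fixes S :: "'a::real_normed_vector set" and f :: "'a \<Rightarrow> real"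
  assumes S: "subspace S" and "0 \<le> M"
    and add: "\<And>x y. x \<in> S \<Longrightarrow> y \<in> S \<Longrightarrow> f (x + y) = f x + f y"
    and scale: "\<And>c x. x \<in> S \<Longrightarrow> f (c *\<^sub>R x) = c * f x"
    and bound: "\<And>x. x \<in> S \<Longrightarrow> f x \<le> M * norm x"
  obtains g where "linear g" "\<And>x. x \<in> S \<Longrightarrow> g x = f x" "\<And>x. \<bar>g x\<bar> \<le> M * norm x"
proof -
  \<comment> \<open>Zorn's lemma is applied to graphs. The bound makes every such subspace single-valued: it forces
    \<open>a \<le> 0\<close> for \<open>(0, a) \<in> G\<close>.\<close>
  define \<A> :: "('a \<times> real) set set" where
    "\<A> = {G. subspace G \<and> (\<forall>x a. (x, a) \<in> G \<longrightarrow> a \<le> M * norm x) \<and> (\<lambda>x. (x, f x)) ` S \<subseteq> G}"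
  define G0 where "G0 = (\<lambda>x. (x, f x)) ` S"
  have "f 0 = 0"
    using scale[of 0 0] subspace_0[OF S] by simp
  have "G0 \<in> \<A>"
    unfolding \<A>_def
  proof (intro CollectI conjI allI impI)
    show "subspace G0"
      unfolding subspace_def G0_def using S \<open>f 0 = 0\<close>
      by (auto simp: subspace_0 zero_prod_def image_iff add scale subspace_add subspace_scale)
  qed (auto simp: G0_def bound)
  then have "\<A> \<noteq> {}"
    by blast
  moreover have "\<Union>\<C> \<in> \<A>" if "\<C> \<noteq> {}" and chain: "subset.chain \<A> \<C>" for \<C>
  proof -
    have "\<C> \<subseteq> \<A>"
      using chain by (simp add: subset_chain_def)
    have "subspace (\<Union>\<C>)"
      unfolding subspace_def
    proof (intro conjI ballI allI)
      show "0 \<in> \<Union>\<C>"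
        using \<open>\<C> \<noteq> {}\<close> \<open>\<C> \<subseteq> \<A>\<close> subspace_0 unfolding \<A>_def by blast
      fix p q assume "p \<in> \<Union>\<C>" "q \<in> \<Union>\<C>"
      then obtain G where "G \<in> \<C>" "p \<in> G" "q \<in> G"
        using chain unfolding subset_chain_def by blast
      then show "p + q \<in> \<Union>\<C>"
        using \<open>\<C> \<subseteq> \<A>\<close> by (auto simp: \<A>_def intro: subspace_add)
    next
      fix c p assume "p \<in> \<Union>\<C>"
      then show "c *\<^sub>R p \<in> \<Union>\<C>"
        using \<open>\<C> \<subseteq> \<A>\<close> by (auto simp: \<A>_def intro: subspace_scale)
    qed
    then show ?thesis
      using \<open>\<C> \<noteq> {}\<close> \<open>\<C> \<subseteq> \<A>\<close> unfolding \<A>_def by blast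
  qed
  ultimately obtain G where "G \<in> \<A>" and max: "\<And>H. H \<in> \<A> \<Longrightarrow> G \<subseteq> H \<Longrightarrow> H = G"
    using subset_Zorn_nonempty[of \<A>] by metis
  then have G: "subspace G" and le: "\<And>x a. (x, a) \<in> G \<Longrightarrow> a \<le> M * norm x"
    and "G0 \<subseteq> G"
    by (auto simp: \<A>_def G0_def)
  have single: "a = b" if "(x, a) \<in> G" "(x, b) \<in> G" for x a b
    using le[of 0 "a - b"] le[of 0 "b - a"] subspace_diff[OF G that] subspace_diff[OF G that(2,1)]
    by simp
  have total: "\<exists>a. (x0, a) \<in> G" for x0
  proof -
    \<comment> \<open>By homogeneity, a value \<open>c\<close> at \<open>x0\<close> is admissible
      once the bound holds at \<open>y + x0\<close> and \<open>x - x0\<close> for all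
      \<open>x\<close>, \<open>y\<close> in the domain of \<open>G\<close>. The latter condition
      bounds \<open>c\<close> below by \<open>L\<close>, the former bounds it above, and
      \<open>gap\<close> says that the two are compatible.\<close>
    define L where "L = (\<lambda>(x, a). a - M * norm (x - x0)) ` G"
    have gap: "a - M * norm (x - x0) \<le> M * norm (y + x0) - b" if "(x, a) \<in> G" "(y, b) \<in> G" for x a y b
    proof -
      have "a + b \<le> M * norm (x + y)"
        using le[of "x + y" "a + b"] subspace_add[OF G that] by simp
      also have "\<dots> \<le> M * (norm (x - x0) + norm (y + x0))"
        using norm_triangle_ineq[of "x - x0" "y + x0"] \<open>0 \<le> M\<close> by (intro mult_left_mono) simp_all
      finally show ?thesis
        by (simp add: algebra_simps)
    qed
    have zero: "(0, 0) \<in> G"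
      using subspace_0[OF G] by (simp add: zero_prod_def)
    define c where "c = Sup L"
    have "bdd_above L"
      unfolding L_def using gap[OF _ zero] by (intro bdd_aboveI[of _ "M * norm x0"]) auto
    then have lower: "a - M * norm (x - x0) \<le> c" if "(x, a) \<in> G" for x a
      unfolding c_def using that by (intro cSup_upper) (auto simp: L_def)
    have upper: "c \<le> M * norm (y + x0) - b" if "(y, b) \<in> G" for y b
      unfolding c_def using zero that gap by (intro cSup_least) (auto simp: L_def)
    let ?H = "span (insert (x0, c) G)"
    have "?H \<in> \<A>"
      unfolding \<A>_def
    proof (intro CollectI conjI allI impI)
      fix x a assume "(x, a) \<in> ?H"
      then obtain k where k: "(x - k *\<^sub>R x0, a - k * c) \<in> G"
        using span_eq_iff[THEN iffD2, OF G] by (auto simp: span_breakdown_eq)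
      \<comment> \<open>Dividing by \<open>k\<close> moves the coefficient of \<open>x0\<close> to
        1. Then \<open>upper\<close> or \<open>lower\<close>, according to the sign of
        \<open>k\<close>, applies to an element of \<open>G\<close> in which \<open>c\<close>
        occurs, and \<open>c\<close> cancels.\<close>
      consider "k = 0" | "k > 0" | "k < 0"
        by linarith
      then show "a \<le> M * norm x"
      proof cases
        case 1
        then show ?thesis
          using le k by simp
      next
        case 2
        have "((1 / k) *\<^sub>R x - x0, a / k - c) \<in> G"
          using subspace_scale[OF G k, of "1 / k"] 2 by (simp add: algebra_simps divide_simps)
        from upper[OF this] have "a / k \<le> M * norm ((1 / k) *\<^sub>R x)"
          by simp
        then show ?thesis
          using 2 by (simp add: field_simps)
      next
        case 3
        have "(x0 - (1 / k) *\<^sub>R x, c - a / k) \<in> G"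
          using subspace_scale[OF G k, of "- 1 / k"] 3 by (simp add: algebra_simps divide_simps)
        from lower[OF this] have "- (a / k) \<le> M * norm ((1 / k) *\<^sub>R x)"
          by simp
        then show ?thesis
          using 3 by (simp add: field_simps)
      qed
    next
      show "(\<lambda>x. (x, f x)) ` S \<subseteq> ?H"
        using \<open>G0 \<subseteq> G\<close> span_superset[of "insert (x0, c) G"] unfolding G0_def by blast
    qed simp
    then have "?H = G"
      by (rule max) (use span_superset in blast)
    then show ?thesis
      using span_base[of "(x0, c)" "insert (x0, c) G"] by auto
  qed
  define g where "g x = (THE a. (x, a) \<in> G)" for x
  have g: "g x = a" if "(x, a) \<in> G" for x a
    unfolding g_def using that single by blast
  have gG: "(x, g x) \<in> G" for x
    using total[of x] g by blast
  show thesis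
  proof
    show "linear g"
    proof (rule linearI)
      show "g (x + y) = g x + g y" for x y
        using g subspace_add[OF G gG[of x] gG[of y]] by simp
      show "g (r *\<^sub>R x) = r *\<^sub>R g x" for r x
        using g subspace_scale[OF G gG[of x], of r] by simp
    qed
    show "g x = f x" if "x \<in> S" for x
      using that \<open>G0 \<subseteq> G\<close> by (intro g) (auto simp: G0_def)
    show "\<bar>g x\<bar> \<le> M * norm x" for x
      using le[OF gG, of x] le[OF subspace_neg[OF G gG[of x], simplified]] by simp
  qed
qed

text \<open>The usual Baire argument, carried out in \<open>S\<close> with its relative topology
  because the functionals are additive and bounded only there. Closedness of \<open>S\<close> makes
  this topology completely metrizable.\<close>

lemma uniform_boundedness_closed_subspace:
  fixes S :: "'a::banach set" and f :: "'i \<Rightarrow> 'a \<Rightarrow> real"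
  assumes S: "subspace S" "closed S"
    and add: "\<And>i x y. x \<in> S \<Longrightarrow> y \<in> S \<Longrightarrow> f i (x + y) = f i x + f i y"
    and scale: "\<And>i c x. x \<in> S \<Longrightarrow> f i (c *\<^sub>R x) = c * f i x"
    and bound: "\<And>i. \<exists>C. \<forall>x\<in>S. \<bar>f i x\<bar> \<le> C * norm x"
    and pointwise: "\<And>x. x \<in> S \<Longrightarrow> \<exists>B. \<forall>i. \<bar>f i x\<bar> \<le> B"
  obtains M where "0 \<le> M" "\<And>i x. x \<in> S \<Longrightarrow> \<bar>f i x\<bar> \<le> M * norm x"
proof -
  have diff: "f i (x - y) = f i x - f i y" if "x \<in> S" "y \<in> S" for i x y
    using add[OF that(1) subspace_neg[OF S(1) that(2)], of i] scale[OF that(2), of i "- 1"] by simp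
  have cont: "continuous_on S (f i)" for i
  proof -
    obtain C where C: "\<And>x. x \<in> S \<Longrightarrow> \<bar>f i x\<bar> \<le> C * norm x"
      using bound by blast
    \<comment> \<open>A Lipschitz constant has to be non-negative, but \<open>C\<close> may be
      negative if \<open>S\<close> is trivial.\<close>
    have "(max C 0)-lipschitz_on S (f i)"
    proof (rule lipschitz_onI)
      fix x y assume "x \<in> S" "y \<in> S"
      then have "\<bar>f i x - f i y\<bar> \<le> C * norm (x - y)"
        using C[of "x - y"] diff[of x y i] subspace_diff[OF S(1)] by simp
      also have "\<dots> \<le> max C 0 * norm (x - y)"
        by (intro mult_right_mono) auto
      finally show "dist (f i x) (f i y) \<le> max C 0 * dist x y"
        by (simp add: dist_norm)
    qed simp
    then show ?thesis
      by (rule lipschitz_on_continuous_on)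
  qed
  define E where "E k = {x \<in> S. \<forall>i. \<bar>f i x\<bar> \<le> real k}" for k :: nat
  have "closedin (top_of_set S) (E k)" for k
  proof -
    have "E k = (\<Inter>i. S \<inter> f i -` {- real k..real k})"
      by (auto simp: E_def abs_le_iff minus_le_iff)
    moreover have closed: "closedin (top_of_set S) (S \<inter> f i -` {- real k..real k})" for i
      using cont by (intro continuous_closedin_preimage) auto
    have "closedin (top_of_set S) (\<Inter>i. S \<inter> f i -` {- real k..real k})"
      by (rule closedin_Inter) (use closed in blast)+
    ultimately show ?thesis
      by simp
  qed
  moreover have "\<Union>(range E) = S"
  proof -
    have "x \<in> \<Union>(range E)" if x: "x \<in> S" for x
    proof -
      obtain b where b: "\<And>i. \<bar>f i x\<bar> \<le> b"
        using pointwise[OF x] by blast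
      obtain k :: nat where "b \<le> real k"
        using real_arch_simple by blast
      then show ?thesis
        using b x order_trans[OF b] by (auto simp: E_def)
    qed
    then show ?thesis
      by (auto simp: E_def)
  qed
  moreover have "completely_metrizable_space (top_of_set S)"
    using S(2) completely_metrizable_space_closedin[OF completely_metrizable_space_euclidean]
    unfolding closed_closedin by blast
  moreover have "top_of_set S interior_of S \<noteq> {}"
    using subspace_0[OF S(1)] interior_of_topspace[of "top_of_set S"] by auto
  ultimately obtain k where "top_of_set S interior_of E k \<noteq> {}"
    using Baire_category_alt[of "top_of_set S" "range E"] by auto
  then obtain x0 T where "openin (top_of_set S) T" "x0 \<in> T" "T \<subseteq> E k"
    by (auto simp: interior_of_def)
  then have "x0 \<in> S" and "\<exists>e>0. ball x0 e \<inter> S \<subseteq> T"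
    unfolding openin_contains_ball by auto
  then obtain e where "e > 0" and e: "ball x0 e \<inter> S \<subseteq> E k"
    using \<open>T \<subseteq> E k\<close> by blast
  have "x0 \<in> E k"
    using e \<open>x0 \<in> S\<close> \<open>e > 0\<close> centre_in_ball by blast
  then have x0: "\<bar>f i x0\<bar> \<le> real k" for i
    by (simp add: E_def)
  show thesis
  proof
    \<comment> \<open>Below, \<open>x\<close> is rescaled to \<open>h\<close> of norm
      \<open>e / 2\<close>. As \<open>x0\<close> and \<open>x0 + h\<close> both lie in
      \<open>E k\<close>, the value at \<open>h\<close> is at most \<open>2 * k\<close>, and undoing
      the scaling multiplies this by \<open>2 * norm x / e\<close>.\<close>
    show "0 \<le> 4 * real k / e"
      using \<open>e > 0\<close> by simp
    fix i x assume "x \<in> S"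
    show "\<bar>f i x\<bar> \<le> 4 * real k / e * norm x"
    proof (cases "x = 0")
      case True
      then show ?thesis
        using scale[OF \<open>x \<in> S\<close>, of i 0] by simp
    next
      case False
      define h where "h = (e / (2 * norm x)) *\<^sub>R x"
      have h: "h \<in> S" "norm h < e"
        using \<open>x \<in> S\<close> False \<open>e > 0\<close> S(1) by (auto simp: h_def subspace_scale)
      have "x0 + h \<in> E k"
        using e h subspace_add[OF S(1) \<open>x0 \<in> S\<close> h(1)] by (auto simp: dist_norm)
      then have "\<bar>f i (x0 + h)\<bar> \<le> real k"
        by (simp add: E_def)
      then have "\<bar>f i h\<bar> \<le> 2 * real k"
        using x0[of i] add[OF \<open>x0 \<in> S\<close> h(1), of i] by linarith
      moreover have "f i h = e / (2 * norm x) * f i x"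
        unfolding h_def by (rule scale[OF \<open>x \<in> S\<close>])
      ultimately show ?thesis
        using False \<open>e > 0\<close> by (simp add: abs_mult field_simps)
    qed
  qed
qed

section \<open>Cluster points of sequences of functions\<close>

text \<open>Cluster points in the topology of pointwise convergence, expressed through its basic
  neighbourhoods. For bounded sequences of linear functionals these are the weak* cluster
  points.\<close>

definition pointwise_cluster :: "(nat \<Rightarrow> 'b \<Rightarrow> real) \<Rightarrow> ('b \<Rightarrow> real) \<Rightarrow> bool" where
  "pointwise_cluster f s \<longleftrightarrow>
     (\<forall>F e N. finite F \<longrightarrow> e > 0 \<longrightarrow> (\<exists>n\<ge>N. \<forall>x\<in>F. \<bar>f n x - s x\<bar> < e))"

text \<open>By Tychonoff's theorem the product of the intervals from \<open>- B x\<close> to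
  \<open>B x\<close> is compact, so the filter generated by the sequence has a cluster point in
  it.\<close>

lemma pointwise_cluster_exists:
  assumes "\<And>n x. \<bar>f n x\<bar> \<le> B x"
  obtains s where "pointwise_cluster f s"
proof -
  let ?K = "PiE UNIV (\<lambda>x. {- B x..B x})"
  have "compact ?K"
    unfolding compactin_euclidean_iff[symmetric] euclidean_product_topology[symmetric] compactin_PiE
    by simp
  moreover have "filtermap f sequentially \<noteq> bot"
    by (simp add: filtermap_bot_iff)
  moreover have "\<forall>\<^sub>F x in filtermap f sequentially. x \<in> ?K"
    using assms by (auto simp: eventually_filtermap PiE_iff abs_le_iff minus_le_iff intro!: always_eventually)
  ultimately obtain s where s: "inf (nhds s) (filtermap f sequentially) \<noteq> bot"
    unfolding compact_filter by blast
  have "\<exists>n\<ge>N. \<forall>x\<in>F. \<bar>f n x - s x\<bar> < e" if "finite F" "e > 0" for F e N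
  proof (rule ccontr)
    assume *: "\<not> ?thesis"
    have "open {g. \<forall>x\<in>F. g x \<in> ball (s x) e}"
      using that by (intro product_topology_basis') auto
    then have "\<forall>\<^sub>F g in nhds s. \<forall>x\<in>F. g x \<in> ball (s x) e"
      using that by (auto simp: eventually_nhds)
    moreover have "\<forall>\<^sub>F g in filtermap f sequentially. \<not> (\<forall>x\<in>F. g x \<in> ball (s x) e)"
      using * by (auto simp: eventually_filtermap eventually_sequentially dist_real_def abs_minus_commute)
    ultimately have "\<forall>\<^sub>F g in inf (nhds s) (filtermap f sequentially). False"
      unfolding eventually_inf by blast
    then show False
      using s trivial_limit_def by blast
  qed
  then show thesis
    using that[of s] by (simp add: pointwise_cluster_def)
qed

lemma pointwise_cluster_subseq:
  assumes "pointwise_cluster (\<lambda>k. f (r k)) s" "strict_mono r"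
  shows "pointwise_cluster f s"
  unfolding pointwise_cluster_def
proof (intro allI impI)
  fix F :: "'a set" and e :: real and N :: nat
  assume "finite F" "e > 0"
  then obtain k where "k \<ge> N" "\<forall>x\<in>F. \<bar>f (r k) x - s x\<bar> < e"
    using assms(1) unfolding pointwise_cluster_def by blast
  moreover have "k \<le> r k"
    using assms(2) by (rule seq_suble)
  ultimately show "\<exists>n\<ge>N. \<forall>x\<in>F. \<bar>f n x - s x\<bar> < e"
    using le_trans by blast
qed

text \<open>The cluster points form a closed set: half of \<open>e\<close> is spent on reaching
  \<open>t\<close>, the other half on reaching some \<open>f n\<close> from there.\<close>

lemma pointwise_cluster_closed:
  assumes "\<And>F e. finite F \<Longrightarrow> e > 0 \<Longrightarrow> \<exists>t. pointwise_cluster f t \<and> (\<forall>x\<in>F. \<bar>t x - s x\<bar> < e)"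
  shows "pointwise_cluster f s"
  unfolding pointwise_cluster_def
proof (intro allI impI)
  fix F :: "'a set" and e :: real and N :: nat
  assume F: "finite F" "e > 0"
  then obtain t where t: "pointwise_cluster f t" "\<forall>x\<in>F. \<bar>t x - s x\<bar> < e / 2"
    using assms[of F "e / 2"] by auto
  then obtain n where "n \<ge> N" "\<forall>x\<in>F. \<bar>f n x - t x\<bar> < e / 2"
    using F half_gt_zero[OF F(2)] unfolding pointwise_cluster_def by blast
  then have "\<forall>x\<in>F. \<bar>f n x - s x\<bar> < e"
    using t(2) by (smt (verit, best) field_sum_of_halves)
  then show "\<exists>n\<ge>N. \<forall>x\<in>F. \<bar>f n x - s x\<bar> < e"
    using \<open>n \<ge> N\<close> by blast
qed

text \<open>A cluster point need not be the limit of a subsequence, but countably many coordinates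
  can be handled diagonally: the index \<open>r k\<close> is chosen to match the first
  \<open>k + 1\<close> points of \<open>P\<close> up to \<open>1 / (k + 1)\<close>.\<close>

lemma pointwise_cluster_convergent_subseq:
  assumes "pointwise_cluster f s" "countable P"
  obtains r where "strict_mono r" "\<And>x. x \<in> P \<Longrightarrow> (\<lambda>k. f (r k) x) \<longlonglongrightarrow> s x"
proof (cases "P = {}")
  case True
  then show thesis
    using that[of id] by (simp add: strict_mono_id)
next
  case False
  define p where "p = from_nat_into P"
  define Q where "Q k n \<longleftrightarrow> (\<forall>i\<le>k. \<bar>f n (p i) - s (p i)\<bar> < 1 / real (Suc k))" for k n :: nat
  have ex: "\<exists>n\<ge>N. Q k n" for k N
    using assms(1)[unfolded pointwise_cluster_def, rule_format, of "p ` {..k}" "1 / real (Suc k)" N]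
    by (auto simp: Q_def)
  have "\<exists>r. \<forall>k. Q k (r k) \<and> r k < r (Suc k)"
    by (intro dependent_nat_choice) (use ex Suc_le_eq in blast)+
  then obtain r where r: "\<And>k. Q k (r k)" "\<And>k. r k < r (Suc k)"
    by blast
  show thesis
  proof
    show "strict_mono r"
      using r(2) by (simp add: strict_mono_Suc_iff)
    fix x assume "x \<in> P"
    then obtain i where i: "x = p i"
      unfolding p_def using assms(2) from_nat_into_surj by metis
    have "(\<lambda>k. f (r k) x - s x) \<longlonglongrightarrow> 0"
    proof (rule Lim_null_comparison)
      show "\<forall>\<^sub>F k in sequentially. norm (f (r k) x - s x) \<le> 1 / real (Suc k)"
        using eventually_ge_at_top[of i]
      proof eventually_elim
        case (elim k)
        then show ?case
          using r(1)[of k] unfolding Q_def i by (auto intro: less_imp_le)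
      qed
      show "(\<lambda>k. 1 / real (Suc k)) \<longlonglongrightarrow> 0"
        using LIMSEQ_inverse_real_of_nat by (simp add: inverse_eq_divide)
    qed
    then show "(\<lambda>k. f (r k) x) \<longlonglongrightarrow> s x"
      by (simp add: LIM_zero_iff)
  qed
qed

lemma pointwise_cluster_eq_limit:
  assumes "pointwise_cluster f s" "(\<lambda>n. f n x) \<longlonglongrightarrow> l"
  shows "s x = l"
proof -
  obtain r where "strict_mono r" "(\<lambda>k. f (r k) x) \<longlonglongrightarrow> s x"
    using pointwise_cluster_convergent_subseq[OF assms(1), of "{x}"] by auto
  then show ?thesis
    using LIMSEQ_unique LIMSEQ_subseq_LIMSEQ[OF assms(2)] by (auto simp: o_def)
qed

lemma pointwise_cluster_linear:
  assumes "pointwise_cluster f s" "\<And>n. linear (f n)"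
  shows "linear s"
proof (rule linearI)
  fix x y
  obtain r where "strict_mono r" and r: "\<And>z. z \<in> {x, y, x + y} \<Longrightarrow> (\<lambda>k. f (r k) z) \<longlonglongrightarrow> s z"
    using pointwise_cluster_convergent_subseq[OF assms(1), of "{x, y, x + y}"] by auto
  have "(\<lambda>k. f (r k) (x + y)) \<longlonglongrightarrow> s x + s y"
    using tendsto_add[OF r r, of x y] by (simp add: linear_add[OF assms(2)])
  then show "s (x + y) = s x + s y"
    using r[of "x + y"] LIMSEQ_unique by blast
next
  fix c x
  obtain r where "strict_mono r" and r: "\<And>z. z \<in> {x, c *\<^sub>R x} \<Longrightarrow> (\<lambda>k. f (r k) z) \<longlonglongrightarrow> s z"
    using pointwise_cluster_convergent_subseq[OF assms(1), of "{x, c *\<^sub>R x}"] by auto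
  have "(\<lambda>k. f (r k) (c *\<^sub>R x)) \<longlonglongrightarrow> c * s x"
    using tendsto_mult_left[OF r, of x c] by (simp add: linear_scale[OF assms(2)])
  then show "s (c *\<^sub>R x) = c *\<^sub>R s x"
    using r[of "c *\<^sub>R x"] LIMSEQ_unique by simp blast
qed

lemma pointwise_cluster_bound:
  assumes "pointwise_cluster f s" "\<And>n. \<bar>f n x\<bar> \<le> B"
  shows "\<bar>s x\<bar> \<le> B"
proof -
  obtain r where "(\<lambda>k. f (r k) x) \<longlonglongrightarrow> s x"
    using pointwise_cluster_convergent_subseq[OF assms(1), of "{x}"] by auto
  then have "(\<lambda>k. \<bar>f (r k) x\<bar>) \<longlonglongrightarrow> \<bar>s x\<bar>"
    by (rule tendsto_rabs)
  then show ?thesis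
    using assms(2) by (intro LIMSEQ_le_const2) auto
qed

text \<open>Take a subsequence converging to \<open>s\<close> on \<open>P\<close>. If it failed to
  converge at some \<open>x\<close>, a further subsequence would stay away from \<open>s x\<close>;
  but any cluster point of that one agrees with \<open>s\<close> on \<open>P\<close>, so it is
  \<open>s\<close>, which is absurd at \<open>x\<close>.\<close>

lemma convergent_subseq_of_countably_determined_cluster:
  assumes bound: "\<And>n x. \<bar>f n x\<bar> \<le> B x"
    and s: "pointwise_cluster f s" and "countable P"
    and unique: "\<And>t. pointwise_cluster f t \<Longrightarrow> (\<And>x. x \<in> P \<Longrightarrow> t x = s x) \<Longrightarrow> t = s"
  obtains r where "strict_mono r" "\<And>x. (\<lambda>k. f (r k) x) \<longlonglongrightarrow> s x"
proof -
  obtain r where r: "strict_mono r" "\<And>x. x \<in> P \<Longrightarrow> (\<lambda>k. f (r k) x) \<longlonglongrightarrow> s x"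
    using pointwise_cluster_convergent_subseq[OF s \<open>countable P\<close>] by metis
  have "(\<lambda>k. f (r k) x) \<longlonglongrightarrow> s x" for x
  proof (rule ccontr)
    assume "\<not> ?thesis"
    then obtain e where "e > 0" and "\<forall>N. \<exists>k\<ge>N. \<not> \<bar>f (r k) x - s x\<bar> < e"
      by (auto simp: lim_sequentially dist_real_def)
    then have "infinite {k. \<not> \<bar>f (r k) x - s x\<bar> < e}"
      unfolding infinite_nat_iff_unbounded_le by blast
    then obtain q :: "nat \<Rightarrow> nat" where q: "strict_mono q" "\<And>k. \<not> \<bar>f (r (q k)) x - s x\<bar> < e"
      using infinite_enumerate by blast
    have rq: "strict_mono (\<lambda>k. r (q k))"
      using r(1) q(1) by (simp add: strict_mono_def)
    obtain t where t: "pointwise_cluster (\<lambda>k. f (r (q k))) t"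
      using pointwise_cluster_exists[of "\<lambda>k. f (r (q k))" B] bound by auto
    have "t y = s y" if "y \<in> P" for y
      using pointwise_cluster_eq_limit[OF t] LIMSEQ_subseq_LIMSEQ[OF r(2)[OF that] q(1)]
      by (simp add: o_def)
    then have "t = s"
      using unique pointwise_cluster_subseq[OF t rq] by blast
    then obtain k where "\<bar>f (r (q k)) x - s x\<bar> < e"
      using t[unfolded pointwise_cluster_def, rule_format, of "{x}" e] \<open>e > 0\<close> by auto
    then show False
      using q(2) by blast
  qed
  then show thesis
    using that r(1) by blast
qed

section \<open>Cantor cubes and the splitting number\<close>

text \<open>The points are subsets of \<open>A\<close> rather than indicator functions, so that for
  a set \<open>A\<close> of reals the cube is one of the topologies on \<open>real set\<close> over
  which \<open>splitting_number\<close> ranges.\<close>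

definition cantor_cube :: "'b set \<Rightarrow> 'b set topology" where
  "cantor_cube A = pullback_topology (Pow A) (\<lambda>S. restrict (\<lambda>a. a \<in> S) A)
     (product_topology (\<lambda>_. discrete_topology UNIV) A)"

lemma topspace_cantor_cube [simp]: "topspace (cantor_cube A) = Pow A"
  by (auto simp: cantor_cube_def topspace_pullback_topology)

lemma cantor_cube_homeomorphic_product:
  "cantor_cube A homeomorphic_space product_topology (\<lambda>_. discrete_topology (UNIV :: bool set)) A"
  (is "_ homeomorphic_space ?P")
proof -
  let ?f = "\<lambda>S. restrict (\<lambda>a. a \<in> S) A" and ?g = "\<lambda>h. {a \<in> A. h a}"
  have fg: "?f (?g h) = h" if "h \<in> topspace ?P" for h
    using that by (auto simp: PiE_iff extensional_def fun_eq_iff)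
  have "continuous_map (cantor_cube A) ?P (id \<circ> ?f)"
    unfolding cantor_cube_def by (rule continuous_map_pullback) (rule continuous_map_id)
  moreover have "continuous_map ?P ?P (?f \<circ> ?g)"
    using fg by (intro continuous_map_eq[OF continuous_map_id]) simp
  then have "continuous_map ?P (cantor_cube A) ?g"
    unfolding cantor_cube_def by (rule continuous_map_pullback') auto
  ultimately have "homeomorphic_maps (cantor_cube A) ?P ?f ?g"
    using fg by (auto simp: homeomorphic_maps_def)
  then show ?thesis
    unfolding homeomorphic_space_def by blast
qed

lemma compact_space_cantor_cube: "compact_space (cantor_cube A)"
  using homeomorphic_compact_space[OF cantor_cube_homeomorphic_product]
  by (simp add: compact_space_product_topology compact_space_discrete_topology)

lemma Hausdorff_space_cantor_cube: "Hausdorff_space (cantor_cube A)"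
  using homeomorphic_Hausdorff_space[OF cantor_cube_homeomorphic_product]
  by (simp add: Hausdorff_space_product_topology Hausdorff_space_discrete_topology)

definition cylinder :: "'b set \<Rightarrow> 'b set \<Rightarrow> 'b set \<Rightarrow> 'b set set" where
  "cylinder A F G = {S. S \<subseteq> A \<and> F \<subseteq> S \<and> G \<inter> S = {}}"

lemma openin_cylinder:
  assumes "finite F" "F \<subseteq> A" "finite G" "G \<subseteq> A"
  shows "openin (cantor_cube A) (cylinder A F G)"
proof -
  define U where "U a = {b. (a \<in> F \<longrightarrow> b) \<and> (a \<in> G \<longrightarrow> \<not> b)}" for a
  have "U a = UNIV" if "a \<notin> F \<union> G" for a
    using that by (simp add: U_def)
  then have "{a \<in> A. U a \<noteq> UNIV} \<subseteq> F \<union> G"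
    by blast
  then have "finite {a \<in> A. U a \<noteq> UNIV}"
    using assms by (meson finite_Un finite_subset)
  then have "openin (product_topology (\<lambda>_. discrete_topology UNIV) A) (PiE A U)"
    by (simp add: openin_PiE_gen)
  moreover have "cylinder A F G = (\<lambda>S. restrict (\<lambda>a. a \<in> S) A) -` PiE A U \<inter> Pow A"
    using assms by (auto simp: cylinder_def U_def PiE_iff)
  ultimately show ?thesis
    unfolding cantor_cube_def openin_pullback_topology by blast
qed

lemma base_of_cantor_cube:
  "base_of (cantor_cube A)
     ((\<lambda>(F, G). cylinder A F G) ` ({F. F \<subseteq> A \<and> finite F} \<times> {F. F \<subseteq> A \<and> finite F}))"
  (is "base_of _ ?B")
  unfolding base_of_def
proof (intro conjI ballI allI impI)
  show "openin (cantor_cube A) V" if "V \<in> ?B" for V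
    using that by (auto intro: openin_cylinder)
  fix W S assume WS: "openin (cantor_cube A) W \<and> S \<in> W"
  let ?f = "\<lambda>S. restrict (\<lambda>a. a \<in> S) A"
  obtain W' where W': "openin (product_topology (\<lambda>_. discrete_topology UNIV) A) W'"
    "W = ?f -` W' \<inter> Pow A"
    using WS unfolding cantor_cube_def openin_pullback_topology by blast
  then obtain U where U: "finite {a \<in> A. U a \<noteq> UNIV}" "?f S \<in> PiE A U" "PiE A U \<subseteq> W'"
    using WS unfolding openin_product_topology_alt by fastforce
  \<comment> \<open>Only the finitely many coordinates in \<open>J\<close> are restricted by the box
    \<open>U\<close>. A cylinder prescribing the values of \<open>S\<close> on \<open>J\<close>
    therefore stays inside it.\<close>
  define J where "J = {a \<in> A. U a \<noteq> UNIV}"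
  have "cylinder A (J \<inter> S) (J - S) \<in> ?B"
    using U(1) by (auto simp: J_def)
  moreover have "S \<in> cylinder A (J \<inter> S) (J - S)"
    using WS W'(2) by (auto simp: cylinder_def)
  moreover have "cylinder A (J \<inter> S) (J - S) \<subseteq> W"
  proof
    fix T assume T: "T \<in> cylinder A (J \<inter> S) (J - S)"
    have "?f T \<in> PiE A U"
    proof (rule PiE_I)
      fix a assume "a \<in> A"
      show "?f T a \<in> U a"
      proof (cases "a \<in> J")
        case True
        then have "?f T a = ?f S a"
          using T \<open>a \<in> A\<close> by (auto simp: cylinder_def)
        then show ?thesis
          using PiE_mem[OF U(2) \<open>a \<in> A\<close>] by simp
      qed (use \<open>a \<in> A\<close> in \<open>auto simp: J_def\<close>)
    qed simp
    then have "T \<in> ?f -` W'"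
      using U(3) by blast
    then show "T \<in> W"
      using T W'(2) by (auto simp: cylinder_def)
  qed
  ultimately show "\<exists>V\<in>?B. S \<in> V \<and> V \<subseteq> W"
    by (intro bexI[of _ "cylinder A (J \<inter> S) (J - S)"] conjI)
qed

text \<open>By induction on \<open>n\<close> there are at most \<open>|A|\<close> subsets with
  \<open>n\<close> elements, since inserting one element maps \<open>A\<close> times the previous
  family onto a superset of the next. A countable union keeps the bound.\<close>

lemma card_of_finite_subsets_ordLeq:
  assumes "infinite A"
  shows "|{F. F \<subseteq> A \<and> finite F}| \<le>o |A|"
proof -
  define \<F> where "\<F> n = {F. F \<subseteq> A \<and> finite F \<and> card F = n}" for n
  have "|\<F> n| \<le>o |A|" for n
  proof (induction n)
    case 0
    have "\<F> 0 = {{}}"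
      by (auto simp: \<F>_def)
    then show ?case
      using assms card_of_ordLeqI[of "\<lambda>_. SOME a. a \<in> A" "{{}}" A] some_in_eq[of A] by auto
  next
    case (Suc n)
    have "\<F> (Suc n) \<subseteq> (\<lambda>(a, F). insert a F) ` (A \<times> \<F> n)"
    proof
      fix F assume "F \<in> \<F> (Suc n)"
      then obtain a G where "F = insert a G" "a \<notin> G" "card G = n" "F \<subseteq> A" "finite F"
        by (auto simp: \<F>_def card_Suc_eq)
      then show "F \<in> (\<lambda>(a, F). insert a F) ` (A \<times> \<F> n)"
        by (auto simp: \<F>_def image_iff)
    qed
    then have "|\<F> (Suc n)| \<le>o |A \<times> \<F> n|"
      by (meson card_of_image card_of_mono1 ordLeq_transitive)
    also have "|A \<times> \<F> n| \<le>o |A|"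
      using assms Suc.IH by (intro card_of_Sigma_ordLeq_infinite) (auto intro: card_of_mono1)
    finally show ?case .
  qed
  moreover have "|UNIV :: nat set| \<le>o |A|"
    using assms infinite_iff_card_of_nat by blast
  ultimately have "|\<Union>n. \<F> n| \<le>o |A|"
    using assms by (intro card_of_UNION_ordLeq_infinite) auto
  moreover have "(\<Union>n. \<F> n) = {F. F \<subseteq> A \<and> finite F}"
    by (auto simp: \<F>_def)
  ultimately show ?thesis
    by simp
qed

lemma weight_ordLeq: "base_of K \<B> \<Longrightarrow> weight K \<le>o |\<B>|"
  unfolding weight_def by (rule min_card(2)) (auto simp: card_of_Card_order)

lemma Card_order_weight: "Card_order (weight K)"
proof -
  have "base_of K {U. openin K U}"
    by (auto simp: base_of_def)
  then have "weight K \<in> {|\<B>| | \<B>. base_of K \<B>}"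
    unfolding weight_def by (intro min_card(1)) (auto simp: card_of_Card_order)
  then show ?thesis
    by (auto simp: card_of_Card_order)
qed

lemma weight_cantor_cube:
  assumes "infinite A"
  shows "weight (cantor_cube A) \<le>o |A|"
proof -
  let ?F = "{F. F \<subseteq> A \<and> finite F}"
  have "weight (cantor_cube A) \<le>o |(\<lambda>(F, G). cylinder A F G) ` (?F \<times> ?F)|"
    by (rule weight_ordLeq[OF base_of_cantor_cube])
  also have "|(\<lambda>(F, G). cylinder A F G) ` (?F \<times> ?F)| \<le>o |?F \<times> ?F|"
    by (rule card_of_image)
  also have "|?F \<times> ?F| \<le>o |A|"
    using assms card_of_finite_subsets_ordLeq[OF assms]
    by (intro card_of_Sigma_ordLeq_infinite) (auto intro: card_of_mono1)
  finally show ?thesis .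
qed

text \<open>The cylinder that decides membership of \<open>a\<close> in the same way as
  \<open>l\<close> is a neighbourhood of \<open>l\<close>.\<close>

lemma limitin_cantor_cube_eventually:
  assumes "limitin (cantor_cube A) f l F" "a \<in> A"
  shows "\<forall>\<^sub>F n in F. a \<in> f n \<longleftrightarrow> a \<in> l"
proof -
  have "l \<subseteq> A"
    using limitin_topspace[OF assms(1)] by simp
  let ?V = "if a \<in> l then cylinder A {a} {} else cylinder A {} {a}"
  have "openin (cantor_cube A) ?V"
    using assms(2) by (auto intro: openin_cylinder)
  moreover have "l \<in> ?V"
    using \<open>l \<subseteq> A\<close> by (auto simp: cylinder_def)
  ultimately have "\<forall>\<^sub>F n in F. f n \<in> ?V"
    using assms(1) unfolding limitin_def by blast
  then show ?thesis
    by (rule eventually_mono) (auto simp: cylinder_def split: if_splits)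
qed

text \<open>Coordinates are coded by sets \<open>N\<close> of naturals, and \<open>f n\<close> has
  coordinate \<open>N\<close> exactly if \<open>n\<close> is in \<open>N\<close>. Given a
  subsequence \<open>r\<close>, the set of every other value of \<open>r\<close> yields a coordinate
  that alternates forever.\<close>

lemma not_seq_compact_cantor_cube_real: "\<not> seq_compact_topology (cantor_cube (UNIV :: real set))"
proof
  assume sc: "seq_compact_topology (cantor_cube (UNIV :: real set))"
  obtain h :: "nat set \<Rightarrow> real" where "inj h"
    using nat_sets_eqpoll_reals by (auto simp: eqpoll_def bij_betw_def)
  define f where "f n = h ` {N. n \<in> N}" for n
  obtain l r where r: "strict_mono r" and l: "limitin (cantor_cube UNIV) (f \<circ> r) l sequentially"
    using sc unfolding seq_compact_topology_def by fastforce
  define N where "N = range (\<lambda>k. r (2 * k))"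
  have "inj r"
    using r by (rule strict_mono_imp_inj_on)
  then have "r k \<in> N \<longleftrightarrow> even k" for k
    by (auto simp: N_def inj_eq elim: evenE)
  then have mem: "h N \<in> (f \<circ> r) k \<longleftrightarrow> even k" for k
    using \<open>inj h\<close> by (simp add: f_def inj_image_mem_iff)
  have "\<forall>\<^sub>F k in sequentially. even k \<longleftrightarrow> h N \<in> l"
    using limitin_cantor_cube_eventually[OF l, of "h N"] by (simp only: mem UNIV_I)
  then obtain m :: nat where m: "\<And>k. k \<ge> m \<Longrightarrow> even k \<longleftrightarrow> h N \<in> l"
    unfolding eventually_sequentially by blast
  from m[of "2 * m"] m[of "2 * m + 1"] show False
    by simp
qed

section \<open>Convergent subsequences below the splitting number\<close>

lemma splitting_number_ordLeq_weight:
  fixes K :: "real set topology"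
  assumes "compact_space K" "Hausdorff_space K" "\<not> seq_compact_topology K"
  shows "splitting_number \<le>o weight K"
  unfolding splitting_number_def using assms
  by (intro min_card(2)) (auto intro: Card_order_weight)

text \<open>This lets every index set smaller than the splitting number be embedded into the
  reals.\<close>

lemma splitting_number_ordLeq_continuum: "splitting_number \<le>o |UNIV :: real set|"
  using splitting_number_ordLeq_weight[OF compact_space_cantor_cube Hausdorff_space_cantor_cube
      not_seq_compact_cantor_cube_real] weight_cantor_cube[OF infinite_UNIV_char_0]
  by (rule ordLeq_transitive)

text \<open>Sequential compactness of the cube over a copy of \<open>D\<close> inside the reals:
  otherwise this cube, whose weight is at most \<open>|D|\<close>, would bound the splitting number
  by \<open>|D|\<close>.\<close>

lemma eventually_constant_subseq:
  fixes f :: "nat \<Rightarrow> 'd \<Rightarrow> bool"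
  assumes "infinite D" "|D| <o splitting_number"
  obtains r where "strict_mono r" "\<And>d. d \<in> D \<Longrightarrow> \<exists>b. \<forall>\<^sub>F k in sequentially. f (r k) d = b"
proof -
  have "|D| \<le>o |UNIV :: real set|"
    using assms(2) splitting_number_ordLeq_continuum ordLess_ordLeq_trans ordLess_imp_ordLeq by blast
  then obtain j :: "'d \<Rightarrow> real" where j: "inj_on j D"
    using card_of_ordLeq by metis
  let ?A = "j ` D"
  have "infinite ?A"
    using assms(1) j finite_imageD by blast
  have "seq_compact_topology (cantor_cube ?A)"
  proof (rule ccontr)
    assume "\<not> ?thesis"
    then have "splitting_number \<le>o weight (cantor_cube ?A)"
      by (intro splitting_number_ordLeq_weight compact_space_cantor_cube Hausdorff_space_cantor_cube)
    also have "weight (cantor_cube ?A) \<le>o |?A|"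
      by (rule weight_cantor_cube[OF \<open>infinite ?A\<close>])
    also have "|?A| \<le>o |D|"
      by (rule card_of_image)
    finally show False
      using assms(2) not_ordLess_ordLeq by blast
  qed
  moreover define g where "g n = j ` {d \<in> D. f n d}" for n
  moreover have "\<forall>n. g n \<in> topspace (cantor_cube ?A)"
    by (auto simp: g_def)
  ultimately obtain l r where r: "strict_mono r" and l: "limitin (cantor_cube ?A) (g \<circ> r) l sequentially"
    unfolding seq_compact_topology_def by blast
  have "\<forall>\<^sub>F k in sequentially. f (r k) d = (j d \<in> l)" if "d \<in> D" for d
  proof -
    have "j d \<in> (g \<circ> r) k \<longleftrightarrow> f (r k) d" for k
      using j that by (auto simp: g_def inj_on_def)
    then show ?thesis
      using limitin_cantor_cube_eventually[OF l, of "j d"] that by simp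
  qed
  then show thesis
    using that r by blast
qed

lemma convergent_if_rational_cuts_eventually_constant:
  fixes u :: "nat \<Rightarrow> real"
  assumes "bounded (range u)"
    and cut: "\<And>q :: rat. \<exists>b. \<forall>\<^sub>F k in sequentially. (u k < of_rat q) = b"
  shows "convergent u"
proof -
  obtain L q where q: "strict_mono q" and L: "(u \<circ> q) \<longlonglongrightarrow> L"
    using bounded_imp_convergent_subsequence[OF assms(1)] by auto
  \<comment> \<open>Since each cut is eventually decided along the whole sequence, the decision can
    be read off from the subsequence converging to \<open>L\<close>.\<close>
  have transfer: "\<forall>\<^sub>F k in sequentially. (u k < of_rat c) = b"
    if "\<forall>\<^sub>F k in sequentially. (u (q k) < of_rat c) = b" for c b
  proof -
    obtain b' where b': "\<forall>\<^sub>F k in sequentially. (u k < of_rat c) = b'"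
      using cut by blast
    have "\<forall>\<^sub>F k in sequentially. (u (q k) < of_rat c) = b'"
      using eventually_subseq[OF q b'] .
    with that have "\<forall>\<^sub>F k in sequentially. b' = b"
      by eventually_elim auto
    then show ?thesis
      using b' by simp
  qed
  have "u \<longlonglongrightarrow> L"
  proof (rule order_tendstoI)
    fix a assume "a < L"
    then obtain c where c: "a < of_rat c" "of_rat c < L"
      using of_rat_dense by blast
    have "\<forall>\<^sub>F k in sequentially. of_rat c < u (q k)"
      using order_tendstoD(1)[OF L c(2)] by (simp add: o_def)
    then have "\<forall>\<^sub>F k in sequentially. (u (q k) < of_rat c) = False"
      by eventually_elim auto
    from transfer[OF this] show "\<forall>\<^sub>F k in sequentially. a < u k"
      by eventually_elim (use c(1) in auto)
  next
    fix a assume "L < a"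
    then obtain c where c: "L < of_rat c" "of_rat c < a"
      using of_rat_dense by blast
    have "\<forall>\<^sub>F k in sequentially. (u (q k) < of_rat c) = True"
      using order_tendstoD(2)[OF L c(1)] by (simp add: o_def)
    from transfer[OF this] show "\<forall>\<^sub>F k in sequentially. u k < a"
      by eventually_elim (use c(2) in auto)
  qed
  then show ?thesis
    by (rule convergentI)
qed

text \<open>A bounded real sequence is coded by its rational cuts, one Boolean sequence for each
  rational. The index set \<open>D\<close> times the rationals is no larger than the infinite set
  \<open>D\<close>.\<close>

lemma convergent_subseq_below_splitting_number:
  fixes f :: "nat \<Rightarrow> 'd \<Rightarrow> real"
  assumes "infinite D" "|D| <o splitting_number"
    and "\<And>n d. d \<in> D \<Longrightarrow> \<bar>f n d\<bar> \<le> B d"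
  obtains r where "strict_mono r" "\<And>d. d \<in> D \<Longrightarrow> convergent (\<lambda>k. f (r k) d)"
proof -
  have "|D \<times> (UNIV :: rat set)| \<le>o |D|"
  proof (rule card_of_Sigma_ordLeq_infinite)
    have "|UNIV :: rat set| \<le>o |UNIV :: nat set|"
      by (rule card_of_ordLeqI[of to_nat]) auto
    then show "\<forall>d\<in>D. |UNIV :: rat set| \<le>o |D|"
      using assms(1) infinite_iff_card_of_nat ordLeq_transitive by blast
  qed (use assms(1) in \<open>auto intro: card_of_mono1\<close>)
  then have "|D \<times> (UNIV :: rat set)| <o splitting_number"
    using assms(2) by (rule ordLeq_ordLess_trans)
  moreover have "infinite (D \<times> (UNIV :: rat set))"
    using assms(1) by (auto simp: finite_cartesian_product_iff)
  ultimately obtain r where r: "strict_mono r" and cut: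
    "\<And>p. p \<in> D \<times> (UNIV :: rat set) \<Longrightarrow>
       \<exists>b. \<forall>\<^sub>F k in sequentially. (\<lambda>(d, c). f (r k) d < of_rat c) p = b"
    using eventually_constant_subseq[of "D \<times> (UNIV :: rat set)" "\<lambda>n (d, c). f n d < of_rat c"]
    by metis
  show thesis
  proof (rule that[OF r])
    fix d assume "d \<in> D"
    show "convergent (\<lambda>k. f (r k) d)"
    proof (rule convergent_if_rational_cuts_eventually_constant)
      show "bounded (range (\<lambda>k. f (r k) d))"
        using assms(3)[OF \<open>d \<in> D\<close>] by (auto simp: bounded_iff)
      show "\<exists>b. \<forall>\<^sub>F k in sequentially. (f (r k) d < of_rat c) = b" for c
        using cut[of "(d, c)"] \<open>d \<in> D\<close> by simp
    qed
  qed
qed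

section \<open>Weak* convergence and the dual of the quotient\<close>

lemma dual_whole_space_iff:
  "f \<in> dual whole_space \<longleftrightarrow> linear f \<and> (\<exists>C. \<forall>x. \<bar>f x\<bar> \<le> C * norm x)"
  by (auto simp: dual_def linear_subspace_def linear_iff)

lemma limitin_weak_star_iff:
  assumes "\<And>n. f n \<in> dual Z"
  shows "limitin (weak_star Z) f l sequentially \<longleftrightarrow>
    l \<in> dual Z \<and> (\<forall>x\<in>points Z. (\<lambda>n. f n x) \<longlonglongrightarrow> l x)"
  using assms
  by (auto simp: weak_star_def limitin_subtopology limitin_componentwise dual_def PiE_iff)

lemma weak_star_convergent_whole_space:
  assumes lin: "\<And>n. linear (f n)" and bound: "\<And>n x. \<bar>f n x\<bar> \<le> M * norm x"
    and conv: "\<And>x. convergent (\<lambda>n. f n x)"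
  shows "weak_star_convergent whole_space f"
proof -
  define l where "l x = lim (\<lambda>n. f n x)" for x
  have l: "(\<lambda>n. f n x) \<longlonglongrightarrow> l x" for x
    unfolding l_def using conv by (simp add: convergent_LIMSEQ_iff)
  have "linear l"
  proof (rule linearI)
    show "l (x + y) = l x + l y" for x y
      using LIMSEQ_unique[OF l[of "x + y"]] tendsto_add[OF l[of x] l[of y]]
      by (simp add: linear_add[OF lin])
    show "l (c *\<^sub>R x) = c *\<^sub>R l x" for c x
      using LIMSEQ_unique[OF l[of "c *\<^sub>R x"]] tendsto_mult_left[OF l[of x], of c]
      by (simp add: linear_scale[OF lin])
  qed
  moreover have "\<bar>l x\<bar> \<le> M * norm x" for x
    using tendsto_rabs[OF l[of x]] bound by (intro LIMSEQ_le_const2) auto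
  ultimately have "l \<in> dual whole_space"
    by (auto simp: dual_whole_space_iff)
  moreover have f: "f n \<in> dual whole_space" for n
    using lin bound by (auto simp: dual_whole_space_iff)
  ultimately show ?thesis
    unfolding weak_star_convergent_def using limitin_weak_star_iff[of f whole_space l] l by blast
qed

text \<open>Reduces extensibility to bounded sequences on the whole space that tend to 0 on
  \<open>Y\<close>: extend the differences \<open>u n - l\<close> with a common bound, pass to a
  subsequence, and add an extension \<open>L\<close> of the limit.\<close>

lemma weak_star_extensibleI:
  fixes Y :: "'a::banach set"
  assumes Y: "subspace Y" "closed Y"
    and subseq: "\<And>M f. 0 < M \<Longrightarrow> (\<And>n. linear (f n)) \<Longrightarrow> (\<And>n x. \<bar>f n x\<bar> \<le> M * norm x) \<Longrightarrow>
      (\<And>y. y \<in> Y \<Longrightarrow> (\<lambda>n. f n y) \<longlonglongrightarrow> 0) \<Longrightarrow>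
      \<exists>r. strict_mono (r :: nat \<Rightarrow> nat) \<and> (\<forall>x. convergent (\<lambda>k. f (r k) x))"
  shows "weak_star_extensible Y"
  unfolding weak_star_extensible_def
proof (intro allI impI)
  fix u assume "weak_star_convergent (linear_subspace Y) u"
  then obtain l where u: "\<And>n. u n \<in> dual (linear_subspace Y)"
    and "limitin (weak_star (linear_subspace Y)) u l sequentially"
    by (auto simp: weak_star_convergent_def)
  then have l: "l \<in> dual (linear_subspace Y)" and lim: "\<And>y. y \<in> Y \<Longrightarrow> (\<lambda>n. u n y) \<longlonglongrightarrow> l y"
    by (auto simp: limitin_weak_star_iff linear_subspace_def)
  have dual_add: "\<phi> (x + y) = \<phi> x + \<phi> y" if "\<phi> \<in> dual (linear_subspace Y)" "x \<in> Y" "y \<in> Y" for \<phi> x y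
    using that by (simp add: dual_def linear_subspace_def)
  have dual_scale: "\<phi> (c *\<^sub>R x) = c * \<phi> x" if "\<phi> \<in> dual (linear_subspace Y)" "x \<in> Y" for \<phi> c x
    using that by (simp add: dual_def linear_subspace_def)
  have dual_bound: "\<exists>C. \<forall>x\<in>Y. \<bar>\<phi> x\<bar> \<le> C * norm x" if "\<phi> \<in> dual (linear_subspace Y)" for \<phi>
    using that by (simp add: dual_def linear_subspace_def)
  define v where "v n y = u n y - l y" for n y
  have v_add: "v n (x + y) = v n x + v n y" if "x \<in> Y" "y \<in> Y" for n x y
    using dual_add[OF u that] dual_add[OF l that] by (simp add: v_def)
  have v_scale: "v n (c *\<^sub>R x) = c * v n x" if "x \<in> Y" for n c x
    using dual_scale[OF u that] dual_scale[OF l that] by (simp add: v_def algebra_simps)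
  have v_lim: "(\<lambda>n. v n y) \<longlonglongrightarrow> 0" if "y \<in> Y" for y
    unfolding v_def using lim[OF that] by (simp add: LIM_zero_iff)
  have v_bound: "\<exists>C. \<forall>x\<in>Y. \<bar>v n x\<bar> \<le> C * norm x" for n
  proof -
    obtain C1 C2 where "\<forall>x\<in>Y. \<bar>u n x\<bar> \<le> C1 * norm x" "\<forall>x\<in>Y. \<bar>l x\<bar> \<le> C2 * norm x"
      using dual_bound[OF u[of n]] dual_bound[OF l] by blast
    then have "\<forall>x\<in>Y. \<bar>v n x\<bar> \<le> (C1 + C2) * norm x"
      by (fastforce simp: v_def distrib_right)
    then show ?thesis
      by blast
  qed
  have v_pointwise: "\<exists>B. \<forall>n. \<bar>v n y\<bar> \<le> B" if "y \<in> Y" for y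
    using convergent_imp_Bseq[OF convergentI[OF v_lim[OF that]]] by (auto simp: Bseq_def)
  obtain M where M: "0 \<le> M" "\<And>n y. y \<in> Y \<Longrightarrow> \<bar>v n y\<bar> \<le> M * norm y"
    using uniform_boundedness_closed_subspace[of Y v, OF Y v_add v_scale v_bound v_pointwise] by blast
  have "\<exists>g. linear g \<and> (\<forall>y\<in>Y. g y = v n y) \<and> (\<forall>x. \<bar>g x\<bar> \<le> M * norm x)" for n
  proof -
    have "v n y \<le> M * norm y" if "y \<in> Y" for y
      using M(2)[OF that, of n] by simp
    then show ?thesis
      using Hahn_Banach_extension[of Y M "v n", OF Y(1) M(1) v_add v_scale] by metis
  qed
  then obtain f where f: "\<And>n. linear (f n)" "\<And>n y. y \<in> Y \<Longrightarrow> f n y = v n y"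
    "\<And>n x. \<bar>f n x\<bar> \<le> M * norm x"
    by metis
  obtain L where L: "linear L" "\<And>y. y \<in> Y \<Longrightarrow> L y = l y" and "\<exists>C. \<forall>x. \<bar>L x\<bar> \<le> C * norm x"
  proof -
    obtain C where C: "\<forall>x\<in>Y. \<bar>l x\<bar> \<le> C * norm x"
      using dual_bound[OF l] by blast
    \<comment> \<open>The extension lemma asks for a non-negative constant.\<close>
    have "l y \<le> \<bar>C\<bar> * norm y" if "y \<in> Y" for y
    proof -
      have "l y \<le> C * norm y"
        using C that by fastforce
      also have "\<dots> \<le> \<bar>C\<bar> * norm y"
        by (intro mult_right_mono) auto
      finally show ?thesis .
    qed
    then obtain g where "linear g" "\<And>y. y \<in> Y \<Longrightarrow> g y = l y" "\<And>x. \<bar>g x\<bar> \<le> \<bar>C\<bar> * norm x"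
      using Hahn_Banach_extension[of Y "\<bar>C\<bar>" l, OF Y(1) abs_ge_zero dual_add[OF l] dual_scale[OF l]]
      by metis
    then show thesis
      using that by blast
  qed
  then obtain C where C: "\<And>x. \<bar>L x\<bar> \<le> C * norm x"
    by blast
  \<comment> \<open>Here \<open>M\<close> may be 0, while \<open>subseq\<close> wants a positive
    bound, by which functionals can be divided.\<close>
  have "\<bar>f n x\<bar> \<le> (M + 1) * norm x" for n x
    using f(3)[of n x] by (simp add: distrib_right add_increasing2)
  moreover have "(\<lambda>n. f n y) \<longlonglongrightarrow> 0" if "y \<in> Y" for y
    using v_lim[OF that] f(2)[OF that] by simp
  ultimately obtain r :: "nat \<Rightarrow> nat" where r: "strict_mono r" "\<And>x. convergent (\<lambda>k. f (r k) x)"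
    using subseq[of "M + 1" f] f(1) M(1) by auto
  define g where "g k x = f (r k) x + L x" for k x
  have "weak_star_convergent whole_space g"
  proof (rule weak_star_convergent_whole_space)
    show "linear (g k)" for k
      unfolding g_def using f(1) L(1) by (rule linear_compose_add)
    show "\<bar>g k x\<bar> \<le> (M + C) * norm x" for k x
      using abs_triangle_ineq[of "f (r k) x" "L x"] f(3)[of "r k" x] C[of x]
      by (simp add: g_def distrib_right)
    show "convergent (\<lambda>k. g k x)" for x
      unfolding g_def using r(2) by (intro convergent_add convergent_const)
  qed
  moreover have "restrict (g k) Y = u (r k)" for k
  proof (rule extensionalityI)
    show "u (r k) \<in> extensional Y"
      using u[of "r k"] by (simp add: dual_def linear_subspace_def)
    show "restrict (g k) Y y = u (r k) y" if "y \<in> Y" for y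
      using that by (simp add: g_def f(2) L(2) v_def)
  qed simp
  ultimately show "\<exists>r g. strict_mono (r :: nat \<Rightarrow> nat) \<and> weak_star_convergent whole_space g \<and>
      (\<forall>k. restrict (g k) Y = u (r k))"
    using r(1) by blast
qed

section \<open>Cosets, the quotient norm and the density of the quotient\<close>

lemma coset_eq_iff:
  fixes Y :: "'a::real_vector set"
  assumes "subspace Y"
  shows "x +o Y = z +o Y \<longleftrightarrow> x - z \<in> Y"
proof
  assume "x +o Y = z +o Y"
  moreover have "x \<in> x +o Y"
    using subspace_0[OF assms] by (force simp: elt_set_plus_def)
  ultimately show "x - z \<in> Y"
    by (auto simp: elt_set_plus_def)
next
  assume *: "x - z \<in> Y"
  have sub: "a +o Y \<subseteq> b +o Y" if "a - b \<in> Y" for a b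
  proof
    fix w assume "w \<in> a +o Y"
    then obtain y where "y \<in> Y" "w = a + y"
      by (auto simp: elt_set_plus_def)
    then have "w = b + ((a - b) + y)" "(a - b) + y \<in> Y"
      using that assms by (auto simp: subspace_add)
    then show "w \<in> b +o Y"
      unfolding elt_set_plus_def by blast
  qed
  show "x +o Y = z +o Y"
    using sub[OF *] sub[of z x] subspace_neg[OF assms *] by simp
qed

lemma points_quotient_space: "points (quotient_space Y) = range (\<lambda>x. x +o Y)"
  by (simp add: quotient_space_def)

lemma nrm_quotient_space: "nrm (quotient_space Y) A = (INF a\<in>A. norm a)"
  by (simp add: quotient_space_def)

text \<open>The infimum over a coset need not be attained; a strict inequality is the form that
  still provides a representative.\<close>

lemma nrm_quotient_space_less_iff:
  fixes Y :: "'a::real_normed_vector set"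
  assumes "subspace Y"
  shows "nrm (quotient_space Y) (x +o Y) < e \<longleftrightarrow> (\<exists>y\<in>Y. norm (x + y) < e)"
proof -
  have "bdd_below (norm ` (x +o Y))"
    by (rule bdd_belowI[of _ 0]) auto
  moreover have "x +o Y \<noteq> {}"
    using subspace_0[OF assms] by (auto simp: elt_set_plus_def)
  ultimately show ?thesis
    by (auto simp: nrm_quotient_space cINF_less_iff elt_set_plus_def)
qed

lemma quotient_space_diff_coset:
  fixes Y :: "'a::real_normed_vector set"
  assumes "subspace Y"
  shows "add (quotient_space Y) (x +o Y) (scale (quotient_space Y) (- 1) (z +o Y)) = (x - z) +o Y"
  using quotient_space_scale_coset[OF assms, of "- 1" z] quotient_space_add_coset[OF assms, of x "- z"]
  by simp

text \<open>\<open>min_card\<close> picks a member only from a non-empty family of cardinals, so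
  some dense set must be exhibited: the whole quotient.\<close>

lemma dens_quotient_space:
  fixes Y :: "'a::real_normed_vector set"
  assumes "subspace Y"
  obtains D where "dense_in_nspace (quotient_space Y) D" "dens (quotient_space Y) = |D|"
proof -
  have "dense_in_nspace (quotient_space Y) (points (quotient_space Y))"
    unfolding dense_in_nspace_def points_quotient_space
  proof (intro conjI ballI allI impI)
    fix A and e :: real assume "A \<in> range (\<lambda>x. x +o Y)" "e > 0"
    then obtain x where x: "A = x +o Y"
      by blast
    have "nrm (quotient_space Y) (0 +o Y) < e"
      unfolding nrm_quotient_space_less_iff[OF assms]
      using \<open>e > 0\<close> subspace_0[OF assms] by force
    then have "nrm (quotient_space Y) (add (quotient_space Y) A (scale (quotient_space Y) (- 1) A)) < e"
      by (simp add: x quotient_space_diff_coset[OF assms])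
    then show "\<exists>d\<in>range (\<lambda>x. x +o Y).
        nrm (quotient_space Y) (add (quotient_space Y) A (scale (quotient_space Y) (- 1) d)) < e"
      using x by blast
  qed simp
  then have "dens (quotient_space Y) \<in> {|D| | D. dense_in_nspace (quotient_space Y) D}"
    unfolding dens_def by (intro min_card(1)) (auto simp: card_of_Card_order)
  then show thesis
    using that by blast
qed

section \<open>The case of small density\<close>

lemma convergent_if_nearly_constant:
  fixes u :: "nat \<Rightarrow> real"
  assumes "\<And>e. e > 0 \<Longrightarrow> \<exists>c. \<forall>\<^sub>F n in sequentially. \<bar>u n - c\<bar> < e"
  shows "convergent u"
proof (rule Cauchy_convergent, rule metric_CauchyI)
  fix e :: real assume "e > 0"
  then obtain c where "\<forall>\<^sub>F n in sequentially. \<bar>u n - c\<bar> < e / 2"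
    using assms[of "e / 2"] by auto
  then obtain N where N: "\<And>n. n \<ge> N \<Longrightarrow> \<bar>u n - c\<bar> < e / 2"
    unfolding eventually_sequentially by blast
  have "dist (u m) (u n) < e" if "m \<ge> N" "n \<ge> N" for m n
    using N[OF that(1)] N[OF that(2)] unfolding dist_real_def by linarith
  then show "\<exists>N. \<forall>m\<ge>N. \<forall>n\<ge>N. dist (u m) (u n) < e"
    by blast
qed

text \<open>Density in the quotient makes \<open>x\<close> close to some \<open>d - y\<close> with
  \<open>d\<close> in \<open>R\<close> and \<open>y\<close> in \<open>Y\<close>. By the common
  bound, \<open>f n x\<close> is then uniformly close to \<open>f n d - f n y\<close>, which
  converges.\<close>

lemma convergent_if_convergent_on_dense_cosets:
  fixes Y :: "'a::real_normed_vector set"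
  assumes Y: "subspace Y" and D: "dense_in_nspace (quotient_space Y) ((\<lambda>x. x +o Y) ` R)"
    and lin: "\<And>n. linear (f n)" and bound: "\<And>n x. \<bar>f n x\<bar> \<le> M * norm x"
    and Y_conv: "\<And>y. y \<in> Y \<Longrightarrow> convergent (\<lambda>n. f n y)"
    and R_conv: "\<And>x. x \<in> R \<Longrightarrow> convergent (\<lambda>n. f n x)"
  shows "convergent (\<lambda>n. f n x)"
proof (rule convergent_if_nearly_constant)
  fix e :: real assume "e > 0"
  \<comment> \<open>Chosen so that \<open>\<bar>M\<bar> + 1\<close> times it is
    \<open>e / 2\<close>; the summand 1 keeps the factor positive.\<close>
  define \<delta> where "\<delta> = e / (2 * (\<bar>M\<bar> + 1))"
  have "\<delta> > 0"
    using \<open>e > 0\<close> by (simp add: \<delta>_def)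
  moreover have "x +o Y \<in> points (quotient_space Y)"
    by (simp add: points_quotient_space)
  ultimately obtain d where "d \<in> R" and
    "nrm (quotient_space Y) (add (quotient_space Y) (x +o Y) (scale (quotient_space Y) (- 1) (d +o Y))) < \<delta>"
    using D unfolding dense_in_nspace_def by blast
  then obtain y where y: "y \<in> Y" "norm (x - d + y) < \<delta>"
    by (auto simp: quotient_space_diff_coset[OF Y] nrm_quotient_space_less_iff[OF Y])
  have close: "\<bar>f n x - (f n d - f n y)\<bar> < e / 2" for n
  proof -
    have "f n x - (f n d - f n y) = f n (x - d + y)"
      by (simp add: linear_add[OF lin] linear_diff[OF lin])
    then have "\<bar>f n x - (f n d - f n y)\<bar> \<le> M * norm (x - d + y)"
      using bound by simp
    also have "\<dots> \<le> (\<bar>M\<bar> + 1) * norm (x - d + y)"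
      by (intro mult_right_mono) auto
    also have "\<dots> < (\<bar>M\<bar> + 1) * \<delta>"
      using y(2) by (intro mult_strict_left_mono) auto
    also have "\<dots> = e / 2"
      by (simp add: \<delta>_def field_simps)
    finally show ?thesis .
  qed
  have "convergent (\<lambda>n. f n d - f n y)"
    by (intro convergent_diff R_conv Y_conv \<open>d \<in> R\<close> y(1))
  then obtain c where "(\<lambda>n. f n d - f n y) \<longlonglongrightarrow> c"
    unfolding convergent_def by blast
  then have "\<forall>\<^sub>F n in sequentially. dist (f n d - f n y) c < e / 2"
    using \<open>e > 0\<close> by (intro tendstoD) auto
  then have "\<forall>\<^sub>F n in sequentially. \<bar>f n x - c\<bar> < e"
  proof eventually_elim
    case (elim n)
    then show ?case
      using close[of n] unfolding dist_real_def by linarith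
  qed
  then show "\<exists>c. \<forall>\<^sub>F n in sequentially. \<bar>f n x - c\<bar> < e"
    by blast
qed

lemma convergent_subseq_if_small_density:
  fixes Y :: "'a::real_normed_vector set" and f :: "nat \<Rightarrow> 'a \<Rightarrow> real"
  assumes Y: "subspace Y" and dens: "dens (quotient_space Y) <o splitting_number"
    and lin: "\<And>n. linear (f n)" and bound: "\<And>n x. \<bar>f n x\<bar> \<le> M * norm x"
    and Y_conv: "\<And>y. y \<in> Y \<Longrightarrow> (\<lambda>n. f n y) \<longlonglongrightarrow> 0"
  shows "\<exists>r. strict_mono (r :: nat \<Rightarrow> nat) \<and> (\<forall>x. convergent (\<lambda>k. f (r k) x))"
proof -
  obtain D where D: "dense_in_nspace (quotient_space Y) D" and "dens (quotient_space Y) = |D|"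
    using dens_quotient_space[OF Y] by blast
  then have "|D| <o splitting_number"
    using dens by simp
  have "D \<subseteq> range (\<lambda>x. x +o Y)"
    using D by (simp add: dense_in_nspace_def points_quotient_space)
  \<comment> \<open>One representative for each coset in \<open>D\<close>, so that \<open>R\<close>
    is no larger than \<open>D\<close>.\<close>
  then obtain R where R: "D = (\<lambda>x. x +o Y) ` R" and inj: "inj_on (\<lambda>x. x +o Y) R"
    by (metis subset_image_inj)
  have "|R| <o splitting_number"
    using \<open>|D| <o splitting_number\<close> card_of_ordLeqI[OF inj, of D] R ordLeq_ordLess_trans by blast
  obtain r :: "nat \<Rightarrow> nat" where r: "strict_mono r" "\<And>x. x \<in> R \<Longrightarrow> convergent (\<lambda>k. f (r k) x)"
  \<comment> \<open>The weight of the cube \<open>2\<^sup>R\<close> is not bounded by the size of \<open>R\<close> when \<open>R\<close> is finite.\<close>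
  proof (cases "countable R")
    case True
    obtain s where "pointwise_cluster f s"
      using pointwise_cluster_exists[of f, OF bound] .
    then obtain r where "strict_mono r" "\<And>x. x \<in> R \<Longrightarrow> (\<lambda>k. f (r k) x) \<longlonglongrightarrow> s x"
      using pointwise_cluster_convergent_subseq[OF _ True] by blast
    then show thesis
      using that convergentI by blast
  next
    case False
    then have "infinite R"
      using countable_finite by blast
    then show thesis
      using convergent_subseq_below_splitting_number[of R f "\<lambda>x. M * norm x"]
        \<open>|R| <o splitting_number\<close> bound that by blast
  qed
  have "convergent (\<lambda>k. f (r k) y)" if "y \<in> Y" for y
    using LIMSEQ_subseq_LIMSEQ[OF Y_conv[OF that] r(1)] by (auto simp: o_def intro: convergentI)
  then have "convergent (\<lambda>k. f (r k) x)" for x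
    using convergent_if_convergent_on_dense_cosets[of Y R "\<lambda>k. f (r k)", OF Y D[unfolded R] lin bound _ r(2)]
    by blast
  then show ?thesis
    using r(1) by blast
qed

section \<open>The case of G_delta-points\<close>

lemma dual_quotient_space_of_annihilator:
  fixes Y :: "'a::real_normed_vector set"
  assumes Y: "subspace Y" and "0 < M" and "linear s"
    and Y_zero: "\<And>y. y \<in> Y \<Longrightarrow> s y = 0" and bound: "\<And>x. \<bar>s x\<bar> \<le> M * norm x"
  obtains \<phi> where "\<phi> \<in> dual (quotient_space Y)" "\<And>x. M * \<phi> (x +o Y) = s x"
proof -
  \<comment> \<open>The choice of representative is harmless, because \<open>s\<close> vanishes on
    \<open>Y\<close>. Division by \<open>M\<close> normalizes the bound to 1.\<close>
  define \<phi> where "\<phi> = restrict (\<lambda>A. s (SOME a. a \<in> A) / M) (points (quotient_space Y))"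
  have \<phi>: "\<phi> (x +o Y) = s x / M" for x
  proof -
    have "x \<in> x +o Y"
      using subspace_0[OF Y] by (force simp: elt_set_plus_def)
    then have "(SOME a. a \<in> x +o Y) \<in> x +o Y"
      by (rule someI)
    then obtain y where "y \<in> Y" "(SOME a. a \<in> x +o Y) = x + y"
      unfolding elt_set_plus_def by blast
    then show ?thesis
      using \<open>linear s\<close> Y_zero by (simp add: \<phi>_def points_quotient_space linear_add)
  qed
  \<comment> \<open>If this failed, some representative \<open>x + y\<close> would have norm below
    \<open>\<bar>s x / M\<bar>\<close>, against the bound on \<open>s\<close> at
    \<open>x + y\<close>, where \<open>s\<close> has the same value as at \<open>x\<close>.\<close>
  have "\<bar>\<phi> (x +o Y)\<bar> \<le> 1 * nrm (quotient_space Y) (x +o Y)" for x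
  proof (rule ccontr)
    assume "\<not> ?thesis"
    then have "nrm (quotient_space Y) (x +o Y) < \<bar>s x / M\<bar>"
      by (simp add: \<phi>)
    then obtain y where y: "y \<in> Y" "norm (x + y) < \<bar>s x / M\<bar>"
      by (auto simp: nrm_quotient_space_less_iff[OF Y])
    have "\<bar>s x\<bar> \<le> M * norm (x + y)"
      using bound[of "x + y"] Y_zero[OF y(1)] \<open>linear s\<close> by (simp add: linear_add)
    then show False
      using y(2) \<open>0 < M\<close> by (simp add: field_simps)
  qed
  moreover have "\<phi> \<in> extensional (points (quotient_space Y))"
    by (simp add: \<phi>_def)
  ultimately have "\<phi> \<in> dual (quotient_space Y)"
    unfolding dual_def using \<open>linear s\<close>
    by (auto simp: points_quotient_space quotient_space_add_coset[OF Y] quotient_space_scale_coset[OF Y]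
        \<phi> linear_add linear_scale add_divide_distrib
        intro!: exI[of _ 1])
  moreover have "M * \<phi> (x +o Y) = s x" for x
    using \<open>0 < M\<close> by (simp add: \<phi>)
  ultimately show thesis
    using that by blast
qed

text \<open>The bound holds at every representative of a coset, hence also for the infimum of their
  norms.\<close>

lemma in_dual_ball_quotient_space:
  fixes Y :: "'a::real_normed_vector set"
  assumes Y: "subspace Y" and \<phi>: "\<phi> \<in> dual (quotient_space Y)"
    and bound: "\<And>x. \<bar>\<phi> (x +o Y)\<bar> \<le> norm x"
  shows "\<phi> \<in> dual_ball (quotient_space Y)"
proof -
  have le: "\<bar>\<phi> (x +o Y)\<bar> \<le> nrm (quotient_space Y) (x +o Y)" for x
  proof (rule ccontr)
    assume "\<not> ?thesis"
    then obtain y where y: "y \<in> Y" "norm (x + y) < \<bar>\<phi> (x +o Y)\<bar>"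
      by (auto simp: nrm_quotient_space_less_iff[OF Y] not_le)
    then have "(x + y) +o Y = x +o Y"
      by (simp add: coset_eq_iff[OF Y])
    then show False
      using bound[of "x + y"] y(2) by simp
  qed
  \<comment> \<open>A supremum of reals is bounded by its upper bounds only over a non-empty set;
    the zero coset shows that the unit ball is one.\<close>
  have "nrm (quotient_space Y) (0 +o Y) < 1"
    unfolding nrm_quotient_space_less_iff[OF Y] using subspace_0[OF Y] by force
  then have "0 +o Y \<in> {A \<in> points (quotient_space Y). nrm (quotient_space Y) A \<le> 1}"
    unfolding points_quotient_space by (intro CollectI conjI rangeI less_imp_le)
  then have "{A \<in> points (quotient_space Y). nrm (quotient_space Y) A \<le> 1} \<noteq> {}"
    by blast
  then have "dual_norm (quotient_space Y) \<phi> \<le> 1"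
    unfolding dual_norm_def
    by (intro cSUP_least) (auto simp: points_quotient_space intro: order_trans[OF le])
  then show ?thesis
    using \<phi> by (simp add: dual_ball_def)
qed

lemma openin_weak_star_neighbourhood:
  assumes "finite F" "F \<subseteq> points Z" "e > 0"
  shows "openin (weak_star Z) {\<psi> \<in> dual Z. \<forall>A\<in>F. \<bar>\<psi> A - \<phi> A\<bar> < e}"
proof -
  define U where "U A = (if A \<in> F then ball (\<phi> A) e else UNIV)" for A
  have "{A \<in> points Z. U A \<noteq> UNIV} \<subseteq> F"
    by (auto simp: U_def)
  then have "openin (product_topology (\<lambda>_. euclideanreal) (points Z)) (PiE (points Z) U)"
    using assms(1) finite_subset by (auto simp: openin_PiE_gen U_def)
  moreover have "{\<psi> \<in> dual Z. \<forall>A\<in>F. \<bar>\<psi> A - \<phi> A\<bar> < e} = PiE (points Z) U \<inter> dual Z"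
  proof (intro equalityI subsetI)
    fix \<psi> assume "\<psi> \<in> {\<psi> \<in> dual Z. \<forall>A\<in>F. \<bar>\<psi> A - \<phi> A\<bar> < e}"
    then show "\<psi> \<in> PiE (points Z) U \<inter> dual Z"
      by (auto simp: U_def dual_def PiE_iff dist_real_def abs_minus_commute)
  next
    fix \<psi> assume "\<psi> \<in> PiE (points Z) U \<inter> dual Z"
    then have "\<psi> \<in> dual Z" "\<psi> A \<in> U A" if "A \<in> points Z" for A
      using that by auto
    then show "\<psi> \<in> {\<psi> \<in> dual Z. \<forall>A\<in>F. \<bar>\<psi> A - \<phi> A\<bar> < e}"
      using assms(2) \<open>\<psi> \<in> PiE (points Z) U \<inter> dual Z\<close>
      by (fastforce simp: U_def dist_real_def abs_minus_commute)
  qed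
  ultimately show ?thesis
    by (auto simp: weak_star_def openin_subtopology)
qed

text \<open>A basic box around \<open>t\<close> inside the open set restricts only finitely many
  coordinates, and functionals equal to \<open>t\<close> there lie in the box.\<close>

lemma openin_weak_star_finitely_determined:
  assumes "openin (weak_star Z) U" "t \<in> U"
  obtains F where "finite F" "F \<subseteq> points Z"
    "\<And>\<psi>. \<psi> \<in> dual Z \<Longrightarrow> (\<And>A. A \<in> F \<Longrightarrow> \<psi> A = t A) \<Longrightarrow> \<psi> \<in> U"
proof -
  obtain T where T: "openin (product_topology (\<lambda>_. euclideanreal) (points Z)) T" "U = T \<inter> dual Z"
    using assms(1) by (auto simp: weak_star_def openin_subtopology)
  then obtain V where V: "finite {A \<in> points Z. V A \<noteq> UNIV}" "t \<in> PiE (points Z) V" "PiE (points Z) V \<subseteq> T"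
    using assms(2) unfolding openin_product_topology_alt by fastforce
  show thesis
  proof (rule that[OF V(1)])
    fix \<psi> assume \<psi>: "\<psi> \<in> dual Z" "\<And>A. A \<in> {A \<in> points Z. V A \<noteq> UNIV} \<Longrightarrow> \<psi> A = t A"
    have "\<psi> A \<in> V A" if "A \<in> points Z" for A
      using \<psi>(2)[of A] that PiE_mem[OF V(2) that] by (cases "V A = UNIV") auto
    then have "\<psi> \<in> PiE (points Z) V"
      using \<psi>(1) by (auto simp: PiE_iff dual_def)
    then show "\<psi> \<in> U"
      using V(3) T(2) \<psi>(1) by blast
  qed auto
qed

text \<open>Each of the countably many open sets around \<open>t\<close> contains all members of
  \<open>C\<close> that agree with \<open>t\<close> on a suitable finite set. Agreement on the union
  of these finite sets puts a member into the intersection, which is \<open>{t}\<close>.\<close>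

lemma Gdelta_point_countably_determined:
  assumes "Gdelta_point (subtopology (weak_star Z) C) t" "C \<subseteq> dual Z"
  obtains P where "t \<in> C" "countable P" "P \<subseteq> points Z"
    "\<And>\<psi>. \<psi> \<in> C \<Longrightarrow> (\<And>A. A \<in> P \<Longrightarrow> \<psi> A = t A) \<Longrightarrow> \<psi> = t"
proof -
  obtain U where U: "\<And>n :: nat. openin (subtopology (weak_star Z) C) (U n)" "(\<Inter>n. U n) = {t}"
    using assms(1) unfolding Gdelta_point_def by blast
  then have "\<exists>W. openin (weak_star Z) W \<and> U n = W \<inter> C" for n
    by (simp add: openin_subtopology)
  then obtain W where W: "\<And>n. openin (weak_star Z) (W n)" "\<And>n. U n = W n \<inter> C"
    by metis
  have t: "t \<in> W n" "t \<in> C" for n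
    using U(2) W(2) by blast+
  have "\<exists>F. finite F \<and> F \<subseteq> points Z \<and> (\<forall>\<psi>\<in>dual Z. (\<forall>A\<in>F. \<psi> A = t A) \<longrightarrow> \<psi> \<in> W n)" for n
    using openin_weak_star_finitely_determined[OF W(1) t(1)] by metis
  then obtain F where F: "\<And>n. finite (F n)" "\<And>n. F n \<subseteq> points Z"
    "\<And>n \<psi>. \<psi> \<in> dual Z \<Longrightarrow> \<forall>A\<in>F n. \<psi> A = t A \<Longrightarrow> \<psi> \<in> W n"
    by metis
  show thesis
  proof (rule that[OF t(2)])
    show "countable (\<Union>n. F n)"
      using F(1) by (simp add: countable_finite)
    fix \<psi> assume \<psi>: "\<psi> \<in> C" "\<And>A. A \<in> (\<Union>n. F n) \<Longrightarrow> \<psi> A = t A"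
    have "\<psi> \<in> U n" for n
    proof -
      have "\<psi> \<in> W n"
        by (rule F(3)) (use \<psi> assms(2) in blast)+
      then show ?thesis
        using \<psi>(1) W(2) by simp
    qed
    then have "\<psi> \<in> (\<Inter>n. U n)"
      by blast
    then show "\<psi> = t"
      using U(2) by simp
  qed (use F(2) in blast)
qed

lemma convergent_subseq_if_Gdelta_points:
  fixes Y :: "'a::real_normed_vector set" and f :: "nat \<Rightarrow> 'a \<Rightarrow> real"
  assumes Y: "subspace Y"
    and Gdelta: "\<And>C. C \<noteq> {} \<Longrightarrow> C \<subseteq> dual_ball (quotient_space Y) \<Longrightarrow>
      closedin (weak_star (quotient_space Y)) C \<Longrightarrow>
      \<exists>t. Gdelta_point (subtopology (weak_star (quotient_space Y)) C) t"
    and "0 < M" and lin: "\<And>n. linear (f n)" and bound: "\<And>n x. \<bar>f n x\<bar> \<le> M * norm x"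
    and Y_lim: "\<And>y. y \<in> Y \<Longrightarrow> (\<lambda>n. f n y) \<longlonglongrightarrow> 0"
  shows "\<exists>r. strict_mono (r :: nat \<Rightarrow> nat) \<and> (\<forall>x. convergent (\<lambda>k. f (r k) x))"
proof -
  let ?Q = "quotient_space Y"
  \<comment> \<open>Functionals on the quotient are identified with functionals vanishing on
    \<open>Y\<close>. The factor \<open>M\<close> makes cluster points of \<open>f\<close>, which
    are bounded by \<open>M\<close>, correspond to members of the dual unit ball.\<close>
  define lift where "lift \<phi> x = M * \<phi> (x +o Y)" for \<phi> :: "'a set \<Rightarrow> real" and x
  define C where "C = {\<phi> \<in> dual ?Q. pointwise_cluster f (lift \<phi>)}"
  \<comment> \<open>Cluster points inherit linearity and the bound, and they vanish on
    \<open>Y\<close> because \<open>f\<close> tends to 0 there.\<close>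
  have factor: "\<exists>\<phi>\<in>C. lift \<phi> = s" if s: "pointwise_cluster f s" for s
  proof -
    have "s y = 0" if "y \<in> Y" for y
      using pointwise_cluster_eq_limit[OF s Y_lim[OF that]] .
    then obtain \<phi> where "\<phi> \<in> dual ?Q" "\<And>x. M * \<phi> (x +o Y) = s x"
      using dual_quotient_space_of_annihilator[OF Y \<open>0 < M\<close> pointwise_cluster_linear[OF s lin]]
        pointwise_cluster_bound[OF s bound] by metis
    moreover from this have "lift \<phi> = s"
      by (simp add: lift_def fun_eq_iff)
    ultimately show ?thesis
      using s by (auto simp: C_def)
  qed
  have "C \<noteq> {}"
    using pointwise_cluster_exists[of f, OF bound] factor by blast
  moreover have "C \<subseteq> dual_ball ?Q"
  proof
    fix \<phi> assume "\<phi> \<in> C"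
    then have "\<bar>\<phi> (x +o Y)\<bar> \<le> norm x" for x
      using pointwise_cluster_bound[of f "lift \<phi>" x, OF _ bound] \<open>0 < M\<close>
      by (simp add: C_def lift_def abs_mult)
    then show "\<phi> \<in> dual_ball ?Q"
      using \<open>\<phi> \<in> C\<close> by (intro in_dual_ball_quotient_space[OF Y]) (auto simp: C_def)
  qed
  moreover have "closedin (weak_star ?Q) C"
    unfolding closedin_def topspace_weak_star
  proof (intro conjI)
    show "openin (weak_star ?Q) (dual ?Q - C)"
    proof (subst openin_subopen, intro ballI)
      fix \<phi> assume \<phi>: "\<phi> \<in> dual ?Q - C"
      then have "\<not> pointwise_cluster f (lift \<phi>)"
        by (simp add: C_def)
      \<comment> \<open>A functional that is no cluster point has a whole neighbourhood free of
        cluster points. It is pulled back to the quotient with radius \<open>e / M\<close>, since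
        \<open>lift\<close> stretches distances by \<open>M\<close>.\<close>
      then obtain F e where F: "finite F" "e > 0"
        and far: "\<And>s. pointwise_cluster f s \<Longrightarrow> \<not> (\<forall>x\<in>F. \<bar>s x - lift \<phi> x\<bar> < e)"
        using pointwise_cluster_closed[of f "lift \<phi>"] by blast
      let ?T = "{\<psi> \<in> dual ?Q. \<forall>A\<in>(\<lambda>x. x +o Y) ` F. \<bar>\<psi> A - \<phi> A\<bar> < e / M}"
      have "openin (weak_star ?Q) ?T"
        using F \<open>0 < M\<close> by (intro openin_weak_star_neighbourhood) (auto simp: points_quotient_space)
      moreover have "\<phi> \<in> ?T"
        using \<phi> F(2) \<open>0 < M\<close> by simp
      moreover have "\<psi> \<notin> C" if "\<psi> \<in> ?T" for \<psi>
      proof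
        assume "\<psi> \<in> C"
        have "\<bar>lift \<psi> x - lift \<phi> x\<bar> < e" if "x \<in> F" for x
        proof -
          have "\<bar>\<psi> (x +o Y) - \<phi> (x +o Y)\<bar> < e / M"
            using \<open>\<psi> \<in> ?T\<close> that by blast
          moreover have "\<bar>lift \<psi> x - lift \<phi> x\<bar> = M * \<bar>\<psi> (x +o Y) - \<phi> (x +o Y)\<bar>"
            using \<open>0 < M\<close> by (simp add: lift_def abs_mult flip: right_diff_distrib)
          ultimately show ?thesis
            using \<open>0 < M\<close> by (simp add: field_simps)
        qed
        then show False
          using far[of "lift \<psi>"] \<open>\<psi> \<in> C\<close> by (simp add: C_def)
      qed
      ultimately show "\<exists>T. openin (weak_star ?Q) T \<and> \<phi> \<in> T \<and> T \<subseteq> dual ?Q - C"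
        by (intro exI[of _ ?T]) blast
    qed
  qed (auto simp: C_def)
  ultimately obtain t where "Gdelta_point (subtopology (weak_star ?Q) C) t"
    using Gdelta by blast
  then obtain P where "t \<in> C" "countable P" "P \<subseteq> points ?Q"
    and unique: "\<And>\<psi>. \<psi> \<in> C \<Longrightarrow> (\<And>A. A \<in> P \<Longrightarrow> \<psi> A = t A) \<Longrightarrow> \<psi> = t"
    by (rule Gdelta_point_countably_determined) (auto simp: C_def)
  \<comment> \<open>Representatives turn the separating cosets in \<open>P\<close> into points at
    which the sequence itself can be evaluated.\<close>
  then obtain R where R: "countable R" "P = (\<lambda>x. x +o Y) ` R"
    unfolding points_quotient_space by (metis countable_subset_image)
  obtain r where "strict_mono r" "\<And>x. (\<lambda>k. f (r k) x) \<longlonglongrightarrow> lift t x"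
  proof (rule convergent_subseq_of_countably_determined_cluster[OF bound _ R(1)])
    show "pointwise_cluster f (lift t)"
      using \<open>t \<in> C\<close> by (simp add: C_def)
    fix s assume "pointwise_cluster f s" and s: "\<And>x. x \<in> R \<Longrightarrow> s x = lift t x"
    then obtain \<psi> where "\<psi> \<in> C" and \<psi>: "lift \<psi> = s"
      using factor by blast
    have "\<psi> (x +o Y) = t (x +o Y)" if "x \<in> R" for x
      using s[OF that] \<open>0 < M\<close> by (simp add: lift_def flip: \<psi>)
    then have "\<psi> = t"
      using unique[OF \<open>\<psi> \<in> C\<close>] R(2) by blast
    then show "s = lift t"
      using \<psi> by simp
  qed (rule that)
  then show ?thesis
    using convergentI by blast
qed

theorem theorem1p2:
  fixes Y :: "'a::banach set"
  assumes "subspace Y" and "closed Y"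
    and "(\<forall>C. C \<noteq> {} \<and> C \<subseteq> dual_ball (quotient_space Y) \<and>
              closedin (weak_star (quotient_space Y)) C \<longrightarrow>
              (\<exists>t. Gdelta_point (subtopology (weak_star (quotient_space Y)) C) t)) \<or>
         dens (quotient_space Y) <o splitting_number"
  shows "weak_star_extensible Y"
proof (rule weak_star_extensibleI[OF assms(1,2)])
  fix M :: real and f :: "nat \<Rightarrow> 'a \<Rightarrow> real"
  assume f: "0 < M" "\<And>n. linear (f n)" "\<And>n x. \<bar>f n x\<bar> \<le> M * norm x"
    "\<And>y. y \<in> Y \<Longrightarrow> (\<lambda>n. f n y) \<longlonglongrightarrow> 0"
  from assms(3) show "\<exists>r. strict_mono (r :: nat \<Rightarrow> nat) \<and> (\<forall>x. convergent (\<lambda>k. f (r k) x))"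
  proof
    assume "dens (quotient_space Y) <o splitting_number"
    then show ?thesis
      using convergent_subseq_if_small_density[OF assms(1) _ f(2,3,4)] by blast
  next
    assume "\<forall>C. C \<noteq> {} \<and> C \<subseteq> dual_ball (quotient_space Y) \<and>
              closedin (weak_star (quotient_space Y)) C \<longrightarrow>
              (\<exists>t. Gdelta_point (subtopology (weak_star (quotient_space Y)) C) t)"
    then show ?thesis
      using convergent_subseq_if_Gdelta_points[OF assms(1) _ f] by blast
  qed
qed

end
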